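(* Let $\mathcal{X}\subset\mathbb{R}^D\setminus\{0\}$ be a finite set of $N$ points. Suppose that every linear subspace $L\subset\mathbb{R}^D$ with $1\le\dim(L)\le D-1$ satisfies $\frac{|\mathcal{X}\cap L|}{N}<\frac{\dim(L)}{D}$. Let $\boldsymbol\Sigma^{(0)}\in\mathrm{S}_{++}(D)$, and define $\boldsymbol\Sigma^{(k+1)}=T(\boldsymbol\Sigma^{(k)})$ for $k\ge0$. Then the sequence $\boldsymbol\Sigma^{(k)}$ converges to the unique minimizer of $F$ over $\{\boldsymbol\Sigma\in\mathrm{S}_{++}(D):\operatorname{tr}(\boldsymbol\Sigma)=1\}$.
   Context: $\mathrm{S}_{++}(D)$ is the set of real symmetric positive definite $D\times D$ matrices. For $\boldsymbol\Sigma\in\mathrm{S}_{++}(D)$, the function $F$ is defined by $$F(\boldsymbol\Sigma)=\frac{1}{N}\sum_{\boldsymbol{x}\in\mathcal{X}}\log(\boldsymbol{x}^T\boldsymbol\Sigma^{-1}\boldsymbol{x})+\frac{1}{D}\log\det(\boldsymbol\Sigma).$$ The operator $T$ is defined by $$T(\boldsymbol\Sigma)=\frac{\sum_{\boldsymbol{x}\in\mathcal{X}}\frac{\boldsymbol{x}\boldsymbol{x}^T}{\boldsymbol{x}^T\boldsymbol\Sigma^{-1}\boldsymbol{x}}}{\operatorname{tr}\Big(\sum_{\boldsymbol{x}\in\mathcal{X}}\frac{\boldsymbol{x}\boldsymbol{x}^T}{\boldsymbol{x}^T\boldsymbol\Sigma^{-1}\boldsymbol{x}}\Big)}.$$ $|\cdot|$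 denotes cardinality, and $\mathcal{X}\cap L$ is the set of points of $\mathcal{X}$ lying in $L$. *)

theory Defs
  imports "HOL-Analysis.Analysis"
begin

definition spd :: "(real^'n^'n) set" where
  "spd = {S. transpose S = S \<and> (\<forall>x::real^'n. x \<noteq> 0 \<longrightarrow> x \<bullet> (S *v x) > 0)}"

definition outer :: "real^'n \<Rightarrow> real^'n^'n" where
  "outer x = (\<chi> i j. x $ i * x $ j)"

definition Fobj :: "(real^'n) set \<Rightarrow> real^'n^'n \<Rightarrow> real" where
  "Fobj X S = (1 / real (card X)) * (\<Sum>x\<in>X. ln (x \<bullet> (matrix_inv S *v x)))
              + (1 / real CARD('n)) * ln (det S)"

definition Top :: "(real^'n) set \<Rightarrow> real^'n^'n \<Rightarrow> real^'n^'n" where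
  "Top X S = (let M = (\<Sum>x\<in>X. (1 / (x \<bullet> (matrix_inv S *v x))) *\<^sub>R outer x)
              in (1 / trace M) *\<^sub>R M)"

end

theory Submission
  imports Defs
begin

text \<open>
  Write \<open>N\<close> for the number of points and \<open>D\<close> for the dimension. The unnormalised map
  \<open>M(S) = (D/N) \<Sum> x x\<^sup>T / (x\<^sup>T S\<^sup>-\<^sup>1 x)\<close> has the same ray as \<open>Top X S\<close>, and \<open>F\<close> is constant on rays. Since
  \<open>tr (S\<^sup>-\<^sup>1 M(S)) = D\<close>, the tangent bound \<open>ln t \<le> t - 1\<close>, applied to the points and to the eigenvalues of
  \<open>M(S)\<close> relative to \<open>S\<close>, gives \<open>F(M(S)) \<le> F(S)\<close> with equality only if \<open>M(S) = S\<close>.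
  If \<open>M(S) = S\<close>, diagonalise a competitor relative to \<open>S\<close>: Jensen's inequality for \<open>ln\<close> shows that \<open>S\<close> is a
  minimiser, and a second one of trace 1 would put every point into one of two complementary
  eigenspaces, which contradicts the counting hypothesis.
  Sublevel sets of \<open>F\<close> are relatively compact: choose a basis from \<open>X\<close> greedily by increasing
  \<open>x\<^sup>T S\<^sup>-\<^sup>1 x\<close>; summation by parts against the counting hypothesis, together with Hadamard's inequality for
  the Gram matrix of that basis, keeps the determinant of this matrix, scaled to trace 1, away from 0. Every limit
  point of the iteration is therefore a fixed point of \<open>M\<close>, hence the unique minimiser.
\<close>

subsection \<open>Spectral theorem for real symmetric matrices\<close>

lemma inner_matrix_vector_transpose:
  fixes A :: "real^'n^'m"
  shows "x \<bullet> (A *v y) = (transpose A *v x) \<bullet> y"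
  by (simp add: dot_lmul_matrix)

text \<open>A maximiser of the quadratic form on the unit sphere of \<open>S\<close> is an
  eigenvector: a nonzero residual \<open>A *v v - c *\<^sub>R v\<close> would be a direction of
  first-order increase. Working inside an invariant subspace lets the induction below restrict to
  orthogonal complements.\<close>

lemma symmetric_eigenvector_exists:
  fixes A :: "real^'n^'n"
  assumes sym: "transpose A = A" and sub: "subspace S" and inv: "\<And>x. x \<in> S \<Longrightarrow> A *v x \<in> S"
    and nz: "S \<noteq> {0}"
  obtains v c where "v \<in> S" "norm v = 1" "A *v v = c *\<^sub>R v"
proof -
  let ?K = "sphere 0 1 \<inter> S"
  have S0: "0 \<in> S" using sub by (rule subspace_0)
  obtain u where u: "u \<in> S" "u \<noteq> 0" using nz S0 by blast
  have "u /\<^sub>R norm u \<in> ?K" using u sub by (simp add: subspace_scale)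
  then have ne: "?K \<noteq> {}" by blast
  have comp: "compact ?K"
    using closed_subspace[OF sub] by (simp add: compact_Int_closed)
  have "continuous_on ?K (\<lambda>x. x \<bullet> (A *v x))"
    by (intro continuous_intros linear_continuous_on_compose continuous_on_id matrix_vector_mul_linear)
  from continuous_attains_sup[OF comp ne this]
  obtain v where v: "v \<in> ?K" "\<And>x. x \<in> ?K \<Longrightarrow> x \<bullet> (A *v x) \<le> v \<bullet> (A *v v)" by blast
  define c where "c = v \<bullet> (A *v v)"
  have vn: "v \<bullet> v = 1" "v \<in> S" "norm v = 1" using v by (auto simp: norm_eq_1)
  have max: "x \<bullet> (A *v x) \<le> c * (x \<bullet> x)" if "x \<in> S" for x
  proof (cases "x = 0")
    case False
    have "x /\<^sub>R norm x \<in> ?K" using False that sub by (simp add: subspace_scale)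
    from v(2)[OF this] have "(x \<bullet> (A *v x)) / (norm x)^2 \<le> c"
      by (simp add: c_def matrix_vector_mult_scaleR power2_eq_square divide_inverse algebra_simps)
    then show ?thesis using False by (simp add: field_simps dot_square_norm)
  qed simp
  define w where "w = A *v v - c *\<^sub>R v"
  have wS: "w \<in> S" using vn sub inv by (simp add: w_def subspace_diff subspace_scale)
  define d where "d = w \<bullet> (A *v w) - c * (w \<bullet> w)"
  \<comment> \<open>Maximality tested at \<open>v + t *\<^sub>R w\<close>. The constant terms
    cancel, and the linear coefficient is twice
    \<open>w \<bullet> (A *v v) - c * (w \<bullet> v)\<close>, which equals
    \<open>w \<bullet> w\<close>.\<close>
  have dle: "2 * t * (w \<bullet> w) + t^2 * d \<le> 0" for t
  proof -
    have "v + t *\<^sub>R w \<in> S" using vn wS sub by (simp add: subspace_add subspace_scale)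
    note max[OF this]
    moreover have "v \<bullet> (A *v w) = w \<bullet> (A *v v)"
      by (metis inner_commute inner_matrix_vector_transpose sym)
    then have "(v + t *\<^sub>R w) \<bullet> (A *v (v + t *\<^sub>R w)) = c + 2 * t * (w \<bullet> (A *v v)) + t^2 * (w \<bullet> (A *v w))"
      by (simp add: c_def matrix_vector_right_distrib matrix_vector_mult_scaleR inner_add_left inner_add_right
          power2_eq_square ring_distribs)
    moreover have "c * ((v + t *\<^sub>R w) \<bullet> (v + t *\<^sub>R w)) = c + 2 * t * (c * (w \<bullet> v)) + t^2 * (c * (w \<bullet> w))"
      using vn(1) by (simp add: inner_add_left inner_add_right inner_commute power2_eq_square algebra_simps)
    moreover have "w \<bullet> w = w \<bullet> (A *v v) - c * (w \<bullet> v)"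
      by (subst (2) w_def) (simp add: inner_diff_right)
    then have "2 * t * (w \<bullet> w) = 2 * t * (w \<bullet> (A *v v)) - 2 * t * (c * (w \<bullet> v))"
      by (simp only: right_diff_distrib)
    ultimately show ?thesis
      by (simp add: d_def right_diff_distrib)
  qed
  have "w \<bullet> w = 0"
  proof (rule ccontr)
    assume "w \<bullet> w \<noteq> 0"
    then have pos: "w \<bullet> w > 0" by (metis inner_ge_zero less_eq_real_def)
    \<comment> \<open>Small enough for the linear term to dominate the quadratic one; the summand 1
      avoids division by zero when \<open>d\<close> vanishes.\<close>
    define t where "t = (w \<bullet> w) / (\<bar>d\<bar> + 1)"
    have tpos: "t > 0" using pos by (simp add: t_def)
    have "t * \<bar>d\<bar> < w \<bullet> w" using pos by (simp add: t_def field_simps)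
    then have "t * (t * \<bar>d\<bar>) < t * (w \<bullet> w)" using tpos by simp
    moreover have "- (t^2 * d) \<le> t * (t * \<bar>d\<bar>)"
      using mult_left_mono[of "- d" "\<bar>d\<bar>" "t^2"] by (simp add: power2_eq_square mult.assoc)
    moreover have "t * (w \<bullet> w) > 0" using tpos pos by simp
    ultimately show False using dle[of t] by linarith
  qed
  then have "A *v v = c *\<^sub>R v" by (simp add: w_def)
  with vn that show ?thesis by blast
qed

text \<open>Induction on the dimension: split off one unit eigenvector; by symmetry its orthogonal
  complement in \<open>S\<close> is again invariant.\<close>

lemma symmetric_eigenbasis_subspace:
  fixes A :: "real^'n^'n"
  assumes sym: "transpose A = A"
  shows "subspace S \<Longrightarrow> (\<And>x. x \<in> S \<Longrightarrow> A *v x \<in> S) \<Longrightarrow>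
    \<exists>B. B \<subseteq> S \<and> pairwise orthogonal B \<and> (\<forall>b\<in>B. norm b = 1 \<and> (\<exists>c. A *v b = c *\<^sub>R b)) \<and> span B = S"
proof (induction "dim S" arbitrary: S rule: less_induct)
  case less
  show ?case
  proof (cases "S = {0}")
    case True
    then show ?thesis by (intro exI[of _ "{}"]) auto
  next
    case False
    obtain v c where v: "v \<in> S" "norm v = 1" "A *v v = c *\<^sub>R v"
      using symmetric_eigenvector_exists[OF sym less.prems False] by blast
    have vv: "v \<bullet> v = 1" using v by (simp add: norm_eq_1)
    define S' where "S' = S \<inter> {x. v \<bullet> x = 0}"
    have sub': "subspace S'"
      unfolding S'_def by (intro subspace_inter less.prems(1) subspace_hyperplane)
    have inv': "A *v x \<in> S'" if "x \<in> S'" for x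
    proof -
      have "v \<bullet> (A *v x) = (A *v v) \<bullet> x"
        by (metis inner_matrix_vector_transpose sym)
      also have "\<dots> = 0" using that v by (simp add: S'_def)
      finally show ?thesis using that less.prems(2) by (simp add: S'_def)
    qed
    have "v \<notin> S'" using vv by (simp add: S'_def)
    moreover have "S' \<subseteq> S" by (simp add: S'_def)
    ultimately have "S' \<subset> S" using v by blast
    then have "dim S' < dim S"
      by (metis dim_psubset less.prems(1) span_eq_iff sub')
    from less.hyps[OF this sub' inv'] obtain B where B: "B \<subseteq> S'" "pairwise orthogonal B"
        "\<forall>b\<in>B. norm b = 1 \<and> (\<exists>c. A *v b = c *\<^sub>R b)" "span B = S'" by blast
    have "span (insert v B) = S"
    proof
      show "span (insert v B) \<subseteq> S"
        using B v by (intro span_minimal less.prems(1)) (auto simp: S'_def)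
      show "S \<subseteq> span (insert v B)"
      proof
        fix x assume x: "x \<in> S"
        have "x - (v \<bullet> x) *\<^sub>R v \<in> S'"
          using x v vv less.prems(1) by (simp add: S'_def subspace_diff subspace_scale inner_diff_right)
        then show "x \<in> span (insert v B)"
          using B(4) span_breakdown_eq by blast
      qed
    qed
    moreover have "pairwise orthogonal (insert v B)"
      using B by (auto simp: pairwise_insert orthogonal_def S'_def inner_commute)
    ultimately show ?thesis
      using B v by (intro exI[of _ "insert v B"]) (auto simp: S'_def)
  qed
qed

section \<open>Diagonal matrices and orthogonal diagonalisation\<close>

definition diagm :: "('n \<Rightarrow> real) \<Rightarrow> real^'n^'n" where
  "diagm l = (\<chi> i j. if i = j then l i else 0)"

lemma diagm_mult_vec: "diagm l *v x = (\<chi> i. l i * x $ i)"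
  by (simp add: diagm_def matrix_vector_mult_def vec_eq_iff if_distrib[of "\<lambda>a. a * _"] cong: if_cong)

lemma diagm_mult: "diagm l ** diagm m = diagm (\<lambda>i. l i * m i)"
  by (simp add: diagm_def matrix_matrix_mult_def vec_eq_iff if_distrib[of "\<lambda>a. a * _"] cong: if_cong)

lemma transpose_diagm [simp]: "transpose (diagm l) = diagm l"
  by (auto simp: diagm_def transpose_def vec_eq_iff)

lemma diagm_const: "diagm (\<lambda>i. c) = c *\<^sub>R mat 1"
  by (simp add: diagm_def mat_def vec_eq_iff)

lemma det_diagm: "det (diagm l) = (\<Prod>i\<in>UNIV. l i)"
  by (subst det_diagonal) (auto simp: diagm_def)

lemma trace_diagm: "trace (diagm l) = (\<Sum>i\<in>UNIV. l i)"
  by (simp add: trace_def diagm_def)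

lemma inner_diagm: "x \<bullet> (diagm l *v x) = (\<Sum>i\<in>UNIV. l i * (x $ i)^2)"
  by (simp add: diagm_mult_vec inner_vec_def power2_eq_square algebra_simps)

lemma symmetric_diagonalization:
  fixes A :: "real^'n^'n"
  assumes sym: "transpose A = A"
  obtains P l where "orthogonal_matrix P" "A = P ** diagm l ** transpose P"
proof -
  obtain B where B: "pairwise orthogonal B" "\<And>b. b \<in> B \<Longrightarrow> norm b = 1"
      "\<And>b. b \<in> B \<Longrightarrow> \<exists>c. A *v b = c *\<^sub>R b" "span B = UNIV"
    using symmetric_eigenbasis_subspace[OF sym, of UNIV] by auto
  have ind: "independent B"
    using B by (intro pairwise_orthogonal_independent) force+
  then have "card B = CARD('n)"
    using B(4) by (metis dim_UNIV dim_span_eq_card_independent DIM_cart DIM_real mult.right_neutral)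
  moreover have "finite B" using ind by (rule independent_imp_finite)
  ultimately obtain f :: "'n \<Rightarrow> real^'n" where f: "bij_betw f UNIV B"
    using finite_same_card_bij[of "UNIV :: 'n set" B] by auto
  then have fB: "f i \<in> B" for i by (auto simp: bij_betw_def)
  have finj: "f i \<noteq> f j" if "i \<noteq> j" for i j using f that by (auto simp: bij_betw_def inj_on_def)
  obtain l where l: "\<And>i. A *v f i = l i *\<^sub>R f i" using B(3)[OF fB] by metis
  \<comment> \<open>The orthonormal eigenvectors become the columns of \<open>P\<close>, so
    orthonormality says that \<open>P\<close> is orthogonal and the eigenvalue equations say
    \<open>A ** P = P ** diagm l\<close>.\<close>
  define P :: "real^'n^'n" where "P = (\<chi> i j. f j $ i)"
  have col: "column j P = f j" for j by (simp add: P_def column_def)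
  have orth: "orthogonal_matrix P"
    unfolding orthogonal_matrix_orthonormal_columns col
    using B fB finj by (auto simp: pairwise_def)
  have "A ** P = P ** diagm l"
  proof -
    have "(A ** P) $ i $ j = (A *v f j) $ i" for i j
      by (simp add: matrix_matrix_mult_def matrix_vector_mult_def P_def)
    moreover have "(P ** diagm l) $ i $ j = (l j *\<^sub>R f j) $ i" for i j
      by (simp add: matrix_matrix_mult_def P_def diagm_def if_distrib[of "\<lambda>a. _ * a"] cong: if_cong)
    ultimately show ?thesis by (simp add: vec_eq_iff l)
  qed
  then have "A = P ** diagm l ** transpose P"
    by (metis orth orthogonal_matrix_def matrix_mul_assoc matrix_mul_rid)
  with orth that show ?thesis by blast
qed

subsection \<open>Positive definite matrices\<close>

lemma
  fixes A :: "real^'n^'n"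
  assumes "invertible A"
  shows matrix_inv_right: "A ** matrix_inv A = mat 1"
    and matrix_inv_left: "matrix_inv A ** A = mat 1"
proof -
  have "\<exists>A'. A ** A' = mat 1 \<and> A' ** A = mat 1" using assms by (simp add: invertible_def)
  then have "A ** matrix_inv A = mat 1 \<and> matrix_inv A ** A = mat 1"
    unfolding matrix_inv_def by (rule someI_ex)
  then show "A ** matrix_inv A = mat 1" "matrix_inv A ** A = mat 1" by auto
qed

lemma matrix_inv_eqI:
  fixes A :: "real^'n^'n"
  assumes "A ** B = mat 1"
  shows "matrix_inv A = B"
proof -
  have "invertible A" using assms invertible_right_inverse by blast
  then show ?thesis
    by (metis assms matrix_inv_left matrix_mul_assoc matrix_mul_lid matrix_mul_rid)
qed

lemma invertible_matrix_inv:
  fixes A :: "real^'n^'n"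
  assumes "invertible A"
  shows "invertible (matrix_inv A)"
  using assms matrix_inv_left matrix_inv_right unfolding invertible_def by blast

lemma matrix_inv_mult:
  fixes A B :: "real^'n^'n"
  assumes "invertible A" "invertible B"
  shows "matrix_inv (A ** B) = matrix_inv B ** matrix_inv A"
proof (rule matrix_inv_eqI)
  have "A ** B ** (matrix_inv B ** matrix_inv A) = A ** (B ** matrix_inv B) ** matrix_inv A"
    by (simp only: matrix_mul_assoc)
  then show "A ** B ** (matrix_inv B ** matrix_inv A) = mat 1"
    using assms by (simp add: matrix_inv_right)
qed

lemma matrix_inv_transpose:
  fixes A :: "real^'n^'n"
  assumes "invertible A"
  shows "matrix_inv (transpose A) = transpose (matrix_inv A)"
  by (rule matrix_inv_eqI) (metis assms matrix_inv_left matrix_transpose_mul transpose_mat)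

lemma matrix_inv_involution:
  fixes A :: "real^'n^'n"
  assumes "invertible A"
  shows "matrix_inv (matrix_inv A) = A"
  using assms by (intro matrix_inv_eqI matrix_inv_left)

lemma matrix_inv_scaleR:
  fixes A :: "real^'n^'n"
  assumes "invertible A" "c \<noteq> 0"
  shows "matrix_inv (c *\<^sub>R A) = (1 / c) *\<^sub>R matrix_inv A"
  using assms by (intro matrix_inv_eqI)
    (simp add: matrix_inv_right scalar_matrix_assoc[symmetric] matrix_scalar_ac)

lemma det_matrix_inv:
  fixes A :: "real^'n^'n"
  assumes "invertible A"
  shows "det (matrix_inv A) = 1 / det A"
proof -
  have "det A * det (matrix_inv A) = 1"
    using assms by (metis det_I det_mul matrix_inv_right)
  then show ?thesis by (metis nonzero_mult_div_cancel_left mult_zero_left zero_neq_one)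
qed

lemma det_scaleR:
  fixes A :: "real^'n^'n"
  shows "det (c *\<^sub>R A) = c ^ CARD('n) * det A"
proof -
  have "c *\<^sub>R A = matrix ((*\<^sub>R) c) ** A"
    by (simp add: vec_eq_iff matrix_matrix_mult_def matrix_def axis_def if_distrib[of "\<lambda>a. a * _"]
       if_distrib[of "\<lambda>a. _ * a"]  cong: if_cong)
  then show ?thesis by (simp only: det_mul det_matrix_scaleR)
qed

lemma trace_scaleR: "trace (c *\<^sub>R (A::real^'n^'n)) = c * trace A"
  by (simp add: trace_def sum_distrib_left)

lemma trace_similar:
  fixes A C :: "real^'n^'n"
  assumes "invertible C"
  shows "trace (matrix_inv C ** A ** C) = trace A"
  by (metis assms matrix_inv_right matrix_mul_assoc matrix_mul_rid trace_mul_sym)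

section \<open>Congruence and positive definiteness\<close>

lemma transpose_congruence:
  fixes S C :: "real^'n^'n"
  shows "transpose (C ** S ** transpose C) = C ** transpose S ** transpose C"
  by (simp add: matrix_transpose_mul matrix_mul_assoc)

lemma inner_congruence:
  fixes S C :: "real^'n^'n"
  shows "x \<bullet> ((C ** S ** transpose C) *v x) = (transpose C *v x) \<bullet> (S *v (transpose C *v x))"
  by (metis inner_matrix_vector_transpose matrix_vector_mul_assoc)

lemma invertible_vec_nonzero:
  fixes A :: "real^'n^'n"
  assumes "invertible A" "x \<noteq> 0"
  shows "A *v x \<noteq> 0"
  by (metis assms matrix_inv_left matrix_vector_mul_assoc matrix_vector_mul_lid matrix_vector_mult_0_right)

lemma spd_congruence:
  fixes S C :: "real^'n^'n"
  assumes "S \<in> spd" "invertible C"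
  shows "C ** S ** transpose C \<in> spd"
  using assms invertible_vec_nonzero[OF transpose_invertible[OF assms(2)]]
  unfolding spd_def by (simp add: transpose_congruence inner_congruence del: transpose_matrix_vector)

lemma spd_transpose: "S \<in> spd \<Longrightarrow> transpose S = S"
  by (simp add: spd_def)

lemma spd_inner_pos: "S \<in> spd \<Longrightarrow> x \<noteq> 0 \<Longrightarrow> x \<bullet> (S *v x) > 0"
  by (simp add: spd_def)

lemma spd_invertible:
  assumes "S \<in> spd"
  shows "invertible S"
proof -
  have "x = 0" if "S *v x = 0" for x
    using spd_inner_pos[OF assms, of x] that by force
  then show ?thesis
    by (metis invertible_left_inverse matrix_left_invertible_ker)
qed

lemma spd_diagm_iff: "diagm l \<in> spd \<longleftrightarrow> (\<forall>i. l i > 0)"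
proof
  assume s: "diagm l \<in> spd"
  show "\<forall>i. l i > 0"
  proof
    fix i
    have "(\<Sum>j\<in>UNIV. l j * (axis i (1::real) $ j)^2) > 0"
      using spd_inner_pos[OF s, of "axis i 1"] by (simp add: inner_diagm axis_eq_0_iff)
    then show "l i > 0" by (simp add: axis_def if_distrib[of "\<lambda>a. a^2"] if_distrib[of "\<lambda>a. _ * a"] cong: if_cong)
  qed
next
  assume l: "\<forall>i. l i > 0"
  have "(\<Sum>i\<in>UNIV. l i * (x $ i)^2) > 0" if nz: "x \<noteq> 0" for x :: "real^'a"
  proof -
    obtain i where "x $ i \<noteq> 0" using nz by (metis vec_eq_iff zero_index)
    then show ?thesis
      using l by (intro sum_pos2[of _ i]) (auto simp: less_imp_le)
  qed
  then show "diagm l \<in> spd" by (simp add: spd_def inner_diagm)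
qed

lemma orthogonal_matrix_invertible:
  fixes P :: "real^'n^'n"
  assumes "orthogonal_matrix P"
  shows "invertible P" "matrix_inv P = transpose P"
  using assms by (auto simp: orthogonal_matrix_def invertible_def intro: matrix_inv_eqI)

lemma congruence_cancel:
  fixes S C :: "real^'n^'n"
  assumes "invertible C"
  shows "matrix_inv C ** (C ** S ** transpose C) ** transpose (matrix_inv C) = S"
proof -
  have "matrix_inv C ** (C ** S ** transpose C) ** transpose (matrix_inv C)
     = (matrix_inv C ** C) ** S ** (transpose C ** transpose (matrix_inv C))"
    by (simp only: matrix_mul_assoc)
  also have "transpose C ** transpose (matrix_inv C) = mat 1"
    by (metis assms matrix_inv_left matrix_transpose_mul transpose_mat)
  finally show ?thesis by (simp add: assms matrix_inv_left)
qed

lemma spd_diagonalization: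
  fixes S :: "real^'n^'n"
  assumes "S \<in> spd"
  obtains P l where "orthogonal_matrix P" "\<forall>i. l i > 0" "S = P ** diagm l ** transpose P"
proof -
  obtain P l where P: "orthogonal_matrix P" "S = P ** diagm l ** transpose P"
    using symmetric_diagonalization[OF spd_transpose[OF assms]] .
  have inv: "invertible P" by (rule orthogonal_matrix_invertible[OF P(1)])
  have "diagm l \<in> spd"
    using spd_congruence[OF assms invertible_matrix_inv[OF inv]] congruence_cancel[OF inv, of "diagm l"] P by simp
  then have "\<forall>i. l i > 0" by (simp add: spd_diagm_iff)
  then show ?thesis using that P by blast
qed

lemma spd_factorization:
  fixes S :: "real^'n^'n"
  assumes "S \<in> spd"
  obtains C :: "real^'n^'n" where "invertible C" "S = C ** transpose C"
proof -
  obtain P l where P: "orthogonal_matrix P" "\<forall>i. l i > 0" "S = P ** diagm l ** transpose P"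
    using spd_diagonalization[OF assms] .
  define E where "E = diagm (\<lambda>i. sqrt (l i))"
  have EE: "E ** E = diagm l"
    using P(2) by (simp add: E_def diagm_mult less_imp_le)
  have "E \<in> spd" using P(2) by (simp add: E_def spd_diagm_iff)
  then have "invertible (P ** E)"
    by (intro invertible_mult orthogonal_matrix_invertible P spd_invertible)
  moreover have "S = (P ** E) ** transpose (P ** E)"
    by (simp add: P(3) EE[symmetric] matrix_transpose_mul matrix_mul_assoc) (simp add: E_def)
  ultimately show ?thesis using that by blast
qed

text \<open>Factor \<open>S\<close> as \<open>B ** transpose B\<close>, then diagonalise
  \<open>S'\<close> in the coordinates given by \<open>B\<close>. The rotation \<open>P\<close> used
  there cancels in \<open>S\<close>, so \<open>C = B ** P\<close> serves both matrices. The numbers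
  \<open>l i\<close> are the eigenvalues of \<open>S'\<close> relative to \<open>S\<close>.\<close>

lemma spd_simultaneous_diagonalization:
  fixes S S' :: "real^'n^'n"
  assumes "S \<in> spd" "S' \<in> spd"
  obtains C :: "real^'n^'n" and l where "invertible C" "\<forall>i. l i > 0" "S = C ** transpose C" "S' = C ** diagm l ** transpose C"
proof -
  obtain B :: "real^'n^'n" where B: "invertible B" "S = B ** transpose B"
    using spd_factorization[OF assms(1)] .
  note iB = invertible_matrix_inv[OF B(1)]
  obtain P l where P: "orthogonal_matrix P" "\<forall>i. l i > 0"
      "matrix_inv B ** S' ** transpose (matrix_inv B) = P ** diagm l ** transpose P"
    using spd_diagonalization[OF spd_congruence[OF assms(2) iB]] .
  have "S' = B ** (P ** diagm l ** transpose P) ** transpose B"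
    using congruence_cancel[OF iB, of S'] P(3) by (simp add: matrix_inv_involution[OF B(1)])
  then have "S' = (B ** P) ** diagm l ** transpose (B ** P)"
    by (simp add: matrix_transpose_mul matrix_mul_assoc)
  moreover have "S = (B ** P) ** transpose (B ** P)"
  proof -
    have "(B ** P) ** transpose (B ** P) = B ** (P ** transpose P) ** transpose B"
      by (simp add: matrix_transpose_mul matrix_mul_assoc)
    then show ?thesis using P(1) B(2) by (simp add: orthogonal_matrix_def)
  qed
  moreover have "invertible (B ** P)"
    by (intro invertible_mult B orthogonal_matrix_invertible P)
  ultimately show ?thesis using that P(2) by blast
qed

lemma spd_det_pos:
  assumes "S \<in> spd"
  shows "det S > 0"
proof -
  obtain P l where P: "orthogonal_matrix P" "\<forall>i. l i > 0" "S = P ** diagm l ** transpose P"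
    using spd_diagonalization[OF assms] .
  have "det P * det P = 1" using det_orthogonal_matrix[OF P(1)] by auto
  then have "det S = (\<Prod>i\<in>UNIV. l i)"
    unfolding P(3) by (simp add: det_mul det_diagm)
  then show ?thesis using P(2) by (simp add: prod_pos)
qed

lemma spd_matrix_inv:
  assumes "S \<in> spd"
  shows "matrix_inv S \<in> spd"
proof -
  note inv = spd_invertible[OF assms]
  have "matrix_inv S ** S ** transpose (matrix_inv S) = matrix_inv S"
    using assms inv by (metis matrix_inv_left matrix_inv_transpose matrix_mul_lid spd_transpose)
  then show ?thesis using spd_congruence[OF assms invertible_matrix_inv[OF inv]] by simp
qed

lemma spd_scaleR: "S \<in> spd \<Longrightarrow> c > 0 \<Longrightarrow> c *\<^sub>R S \<in> spd"
  by (simp add: spd_def transpose_scalar scaleR_matrix_vector_assoc[symmetric])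

lemma diag_eq_inner: "S $ i $ i = axis i 1 \<bullet> (S *v axis i (1::real))"
  by (simp add: matrix_vector_mult_basis column_def inner_axis')

lemma spd_diag_pos:
  assumes "S \<in> spd"
  shows "S $ i $ i > 0"
  using spd_inner_pos[OF assms, of "axis i 1"] by (simp add: diag_eq_inner axis_eq_0_iff)

lemma spd_trace_pos:
  fixes S :: "real^'n^'n"
  assumes "S \<in> spd"
  shows "trace S > 0"
  unfolding trace_def by (intro sum_pos) (auto simp: spd_diag_pos[OF assms])

text \<open>Semidefiniteness makes every eigenvalue nonnegative and the determinant excludes zero.
  Semidefiniteness survives limits, so this is how limits are recognised as positive
  definite.\<close>

lemma psd_invertible_imp_spd:
  fixes S :: "real^'n^'n"
  assumes sym: "transpose S = S" and psd: "\<And>x. x \<bullet> (S *v x) \<ge> 0" and det: "det S \<noteq> 0"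
  shows "S \<in> spd"
proof -
  obtain P l where P: "orthogonal_matrix P" "S = P ** diagm l ** transpose P"
    using symmetric_diagonalization[OF sym] .
  have inv: "invertible P" by (rule orthogonal_matrix_invertible[OF P(1)])
  have "l i \<ge> 0" for i
  proof -
    have "transpose P *v (P *v axis i 1) = axis i 1"
      using P by (metis matrix_vector_mul_assoc matrix_vector_mul_lid orthogonal_matrix)
    then have "(P *v axis i 1) \<bullet> (S *v (P *v axis i 1)) = axis i 1 \<bullet> (diagm l *v axis i 1)"
      unfolding P(2) inner_congruence by simp
    also have "\<dots> = l i" by (simp add: diag_eq_inner[symmetric]) (simp add: diagm_def)
    finally show ?thesis using psd by metis
  qed
  moreover have "l i \<noteq> 0" for i
    using det unfolding P(2) by (auto simp: det_mul det_diagm)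
  ultimately have "l i > 0" for i by (metis less_eq_real_def)
  then have "diagm l \<in> spd" by (simp add: spd_diagm_iff)
  then show ?thesis unfolding P(2) using inv by (rule spd_congruence)
qed

subsection \<open>Determinant inequalities\<close>

lemma ln_prod_UNIV:
  fixes l :: "'n::finite \<Rightarrow> real"
  assumes "\<forall>i. l i > 0"
  shows "ln (\<Prod>i\<in>UNIV. l i) = (\<Sum>i\<in>UNIV. ln (l i))"
  using assms by (intro ln_prod finite) (metis less_irrefl)

text \<open>Rewrites both parts of the objective, and the trace that links them, in terms of the
  relative eigenvalues \<open>l i\<close> and the coordinates
  \<open>matrix_inv C *v x\<close>.\<close>

lemma
  fixes C :: "real^'n^'n"
  assumes C: "invertible C" and l: "\<forall>i. l i > 0"
  shows inner_inv_congruence_diagm: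
      "x \<bullet> (matrix_inv (C ** diagm l ** transpose C) *v x) = (\<Sum>i\<in>UNIV. ((matrix_inv C *v x) $ i)^2 / l i)"
    and trace_inv_congruence_diagm:
      "trace (matrix_inv (C ** transpose C) ** (C ** diagm l ** transpose C)) = (\<Sum>i\<in>UNIV. l i)"
    and ln_det_congruence_diagm:
      "ln (det (C ** diagm l ** transpose C)) = ln (det (C ** transpose C)) + (\<Sum>i\<in>UNIV. ln (l i))"
proof -
  have tC: "invertible (transpose C)" using C by (rule transpose_invertible)
  have d: "invertible (diagm l)" using l by (intro spd_invertible) (simp add: spd_diagm_iff)
  have "l i * (1 / l i) = 1" for i using l by (metis less_irrefl nonzero_mult_div_cancel_left times_divide_eq_right mult_1_right)
  then have dinv: "matrix_inv (diagm l) = diagm (\<lambda>i. 1 / l i)"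
    by (intro matrix_inv_eqI) (simp add: diagm_mult diagm_const)
  have "matrix_inv (C ** diagm l ** transpose C)
      = transpose (matrix_inv C) ** diagm (\<lambda>i. 1 / l i) ** transpose (transpose (matrix_inv C))"
    using C tC d by (simp add: matrix_inv_mult invertible_mult matrix_inv_transpose dinv matrix_mul_assoc)
  then show "x \<bullet> (matrix_inv (C ** diagm l ** transpose C) *v x) = (\<Sum>i\<in>UNIV. ((matrix_inv C *v x) $ i)^2 / l i)"
    by (simp only: inner_congruence) (simp add: inner_diagm divide_inverse mult.commute)
  have "matrix_inv (C ** transpose C) ** (C ** diagm l ** transpose C)
     = matrix_inv (transpose C) ** (matrix_inv C ** C) ** diagm l ** transpose C"
    by (simp only: matrix_inv_mult[OF C tC] matrix_mul_assoc)
  also have "\<dots> = matrix_inv (transpose C) ** diagm l ** transpose C"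
    by (simp add: matrix_inv_left[OF C])
  finally show "trace (matrix_inv (C ** transpose C) ** (C ** diagm l ** transpose C)) = (\<Sum>i\<in>UNIV. l i)"
    by (simp add: trace_similar[OF tC] trace_diagm)
  have "det C \<noteq> 0" using C by (simp add: invertible_det_nz)
  then have "det C * det C > 0" using not_real_square_gt_zero by blast
  moreover have "(\<Prod>i\<in>UNIV. l i) > 0" using l by (simp add: prod_pos)
  ultimately have "ln ((det C * det C) * (\<Prod>i\<in>UNIV. l i)) = ln (det C * det C) + ln (\<Prod>i\<in>UNIV. l i)"
    by (rule ln_mult_pos)
  moreover have "det (C ** diagm l ** transpose C) = (det C * det C) * (\<Prod>i\<in>UNIV. l i)"
    by (simp add: det_mul det_diagm)
  moreover have "det (C ** transpose C) = det C * det C"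
    by (simp add: det_mul)
  ultimately show "ln (det (C ** diagm l ** transpose C)) = ln (det (C ** transpose C)) + (\<Sum>i\<in>UNIV. ln (l i))"
    using ln_prod_UNIV[OF l] by simp
qed

text \<open>The bound \<open>ln t \<le> t - 1\<close> summed over the relative eigenvalues of
  \<open>M\<close>. Equality in the sum forces it in every summand, hence every eigenvalue is
  1.\<close>

lemma ln_det_le_trace:
  fixes S M :: "real^'n^'n"
  assumes "S \<in> spd" "M \<in> spd"
  shows "ln (det M) \<le> ln (det S) + trace (matrix_inv S ** M) - real CARD('n)"
    and "ln (det M) = ln (det S) + trace (matrix_inv S ** M) - real CARD('n) \<Longrightarrow> M = S"
proof -
  obtain C :: "real^'n^'n" and l where C: "invertible C" "\<forall>i. l i > 0" "S = C ** transpose C" "M = C ** diagm l ** transpose C"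
    using spd_simultaneous_diagonalization[OF assms] .
  have ln_le: "ln (l i) \<le> l i - 1" for i using C(2) by (simp add: ln_le_minus_one)
  have tr: "trace (matrix_inv S ** M) - real CARD('n) = (\<Sum>i\<in>UNIV. l i - 1)"
    unfolding C(3,4) trace_inv_congruence_diagm[OF C(1,2)] by (simp add: sum_subtractf)
  have det: "ln (det M) = ln (det S) + (\<Sum>i\<in>UNIV. ln (l i))"
    unfolding C(3,4) by (rule ln_det_congruence_diagm[OF C(1,2)])
  show "ln (det M) \<le> ln (det S) + trace (matrix_inv S ** M) - real CARD('n)"
    using sum_mono[of UNIV "\<lambda>i. ln (l i)" "\<lambda>i. l i - 1"] ln_le tr det by simp
  assume "ln (det M) = ln (det S) + trace (matrix_inv S ** M) - real CARD('n)"
  then have "(\<Sum>i\<in>UNIV. (l i - 1) - ln (l i)) = 0"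
    using tr det by (simp add: sum_subtractf)
  then have "ln (l i) = l i - 1" for i
    using ln_le by (subst (asm) sum_nonneg_eq_0_iff) (auto simp: algebra_simps)
  then have "l i = 1" for i using C(2) ln_eq_minus_one by blast
  then have "diagm l = mat 1" by (simp add: diagm_def mat_def vec_eq_iff)
  then show "M = S" using C by simp
qed

text \<open>Hadamard's inequality: compare \<open>G\<close> with its own diagonal part, for which
  the trace term equals the dimension and cancels.\<close>

lemma ln_det_le_sum_ln_diag:
  fixes G :: "real^'n^'n"
  assumes G: "G \<in> spd"
  shows "ln (det G) \<le> (\<Sum>i\<in>UNIV. ln (G $ i $ i))"
proof -
  let ?E = "diagm (\<lambda>i. G $ i $ i)"
  have pos: "\<forall>i. G $ i $ i > 0" using spd_diag_pos[OF G] by blast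
  then have E: "?E \<in> spd" by (simp add: spd_diagm_iff)
  have nz: "G $ i $ i \<noteq> 0" for i using pos by (metis less_irrefl)
  then have inv: "matrix_inv ?E = diagm (\<lambda>i. 1 / G $ i $ i)"
    by (intro matrix_inv_eqI) (simp add: diagm_mult diagm_const)
  have "trace (matrix_inv ?E ** G) = real CARD('n)"
    unfolding inv using nz
    by (simp add: trace_def matrix_matrix_mult_def diagm_def if_distrib[of "\<lambda>a. a * _"] cong: if_cong)
  then show ?thesis
    using ln_det_le_trace(1)[OF E G] ln_prod_UNIV[OF pos] by (simp add: det_diagm)
qed

text \<open>The tangent of \<open>ln\<close> at the mean \<open>m\<close> lies above the graph and
  touches it only at \<open>m\<close>; averaging gives the inequality, and equality pins down each
  \<open>a j\<close> that carries positive weight.\<close>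

lemma ln_jensen:
  fixes p a :: "'n::finite \<Rightarrow> real"
  assumes p: "\<And>i. p i \<ge> 0" "(\<Sum>i\<in>UNIV. p i) = 1" and a: "\<And>i. a i > 0"
  shows "(\<Sum>i\<in>UNIV. p i * ln (a i)) \<le> ln (\<Sum>i\<in>UNIV. p i * a i)"
    and "ln (\<Sum>i\<in>UNIV. p i * a i) = (\<Sum>i\<in>UNIV. p i * ln (a i)) \<Longrightarrow> p j > 0 \<Longrightarrow> a j = (\<Sum>i\<in>UNIV. p i * a i)"
proof -
  define m where "m = (\<Sum>i\<in>UNIV. p i * a i)"
  obtain k where "p k \<noteq> 0" using p(2) by (metis sum.neutral zero_neq_one)
  then have "m > 0"
    unfolding m_def using p(1) a by (intro sum_pos2[of _ k]) (auto simp: less_le)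
  have le: "ln (a i) \<le> ln m + (a i / m - 1)" for i
  proof -
    have "ln (a i / m) \<le> a i / m - 1" using a \<open>m > 0\<close> by (simp add: ln_le_minus_one)
    then show ?thesis using a[of i] \<open>m > 0\<close> by (simp add: ln_div)
  qed
  have "(\<Sum>i\<in>UNIV. p i * (ln m + (a i / m - 1))) = (ln m - 1) * (\<Sum>i\<in>UNIV. p i) + (\<Sum>i\<in>UNIV. p i * a i) / m"
    by (simp add: sum_distrib_left sum_divide_distrib sum.distrib[symmetric] algebra_simps)
  then have sum: "(\<Sum>i\<in>UNIV. p i * (ln m + (a i / m - 1))) = ln m"
    using p(2) \<open>m > 0\<close> by (simp add: m_def[symmetric])
  have le': "p i * ln (a i) \<le> p i * (ln m + (a i / m - 1))" for i
    by (rule mult_left_mono[OF le p(1)])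
  then have "(\<Sum>i\<in>UNIV. p i * ln (a i)) \<le> (\<Sum>i\<in>UNIV. p i * (ln m + (a i / m - 1)))"
    by (intro sum_mono)
  then show "(\<Sum>i\<in>UNIV. p i * ln (a i)) \<le> ln (\<Sum>i\<in>UNIV. p i * a i)"
    by (simp only: sum m_def[symmetric])
  assume eq: "ln (\<Sum>i\<in>UNIV. p i * a i) = (\<Sum>i\<in>UNIV. p i * ln (a i))" and j: "p j > 0"
  have "(\<Sum>i\<in>UNIV. p i * (ln m + (a i / m - 1)) - p i * ln (a i)) = 0"
    using eq sum unfolding m_def[symmetric] by (simp add: sum_subtractf)
  then have "p j * (ln m + (a j / m - 1)) - p j * ln (a j) = 0"
    using le' by (subst (asm) sum_nonneg_eq_0_iff) auto
  then have "ln (a j) = ln m + (a j / m - 1)" using j by (simp flip: right_diff_distrib)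
  then have "ln (a j / m) = a j / m - 1" using a[of j] \<open>m > 0\<close> by (simp add: ln_div)
  then have "a j / m = 1" using a[of j] \<open>m > 0\<close> ln_eq_minus_one[of "a j / m"] by simp
  then show "a j = (\<Sum>i\<in>UNIV. p i * a i)" using \<open>m > 0\<close> by (simp add: m_def[symmetric])
qed

section \<open>Rank-one matrices and finite sums of matrices\<close>

lemma transpose_outer [simp]: "transpose (outer x) = outer x"
  by (simp add: outer_def transpose_def vec_eq_iff mult.commute)

lemma outer_mult_vec: "outer x *v y = (x \<bullet> y) *\<^sub>R x"
  by (simp add: outer_def matrix_vector_mult_def vec_eq_iff inner_vec_def sum_distrib_left sum_distrib_right mult_ac)

lemma inner_outer: "y \<bullet> (outer x *v y) = (x \<bullet> y)^2"
  by (simp add: outer_mult_vec power2_eq_square inner_commute)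

lemma trace_mult_outer:
  fixes A :: "real^'n^'n"
  shows "trace (A ** outer x) = x \<bullet> (A *v x)"
  by (simp add: trace_def matrix_matrix_mult_def outer_def inner_vec_def matrix_vector_mult_def
      sum_distrib_left mult_ac)

lemma congruence_outer:
  fixes A :: "real^'n^'n"
  shows "A ** outer x ** transpose A = outer (A *v x)"
  by (simp add: outer_def matrix_matrix_mult_def matrix_vector_mult_def transpose_def vec_eq_iff
      sum_distrib_left sum_distrib_right mult_ac sum_product)

lemma matrix_mult_sum_right:
  fixes A :: "real^'n^'n"
  shows "A ** (\<Sum>x\<in>X. f x) = (\<Sum>x\<in>X. A ** f x)"
  by (induction X rule: infinite_finite_induct) (auto simp: matrix_add_ldistrib)

lemma matrix_mult_sum_left:
  fixes A :: "real^'n^'n"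
  shows "(\<Sum>x\<in>X. f x) ** A = (\<Sum>x\<in>X. f x ** A)"
  by (induction X rule: infinite_finite_induct) (auto simp: vec_eq_iff matrix_matrix_mult_def distrib_right sum.distrib)

lemma matrix_sum_mult_vec:
  fixes f :: "'a \<Rightarrow> real^'n^'m"
  shows "(\<Sum>x\<in>X. f x) *v y = (\<Sum>x\<in>X. f x *v y)"
  by (induction X rule: infinite_finite_induct) (auto simp: matrix_vector_mult_add_rdistrib)

lemma transpose_sum:
  fixes f :: "'a \<Rightarrow> real^'n^'m"
  shows "transpose (\<Sum>x\<in>X. f x) = (\<Sum>x\<in>X. transpose (f x))"
  by (simp add: transpose_def vec_eq_iff)

lemma trace_sum:
  fixes f :: "'a \<Rightarrow> real^'n^'n"
  shows "trace (\<Sum>x\<in>X. f x) = (\<Sum>x\<in>X. trace (f x))"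
  unfolding trace_def by (simp) (rule sum.swap)

subsection \<open>Descent property of the iteration\<close>

text \<open>Normalised by a fixed factor and not by the trace: since
  \<open>trace (matrix_inv S ** scatter X S)\<close> is then the dimension, a matrix whose ray is
  preserved is itself a fixed point.\<close>

definition scatter :: "(real^'n) set \<Rightarrow> real^'n^'n \<Rightarrow> real^'n^'n" where
  "scatter X S = (\<Sum>x\<in>X. (real CARD('n) / real (card X) / (x \<bullet> (matrix_inv S *v x))) *\<^sub>R outer x)"

lemma
  fixes A B :: "real^'n^'n"
  shows scaleR_matrix_mult_left: "(c *\<^sub>R A) ** B = c *\<^sub>R (A ** B)"
    and scaleR_matrix_mult_right: "A ** (c *\<^sub>R B) = c *\<^sub>R (A ** B)"
  by (simp_all only: scalar_matrix_assoc matrix_scalar_ac)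

text \<open>With \<open>A\<close> the inverse of a diagonalising matrix, these are the sums of
  relative eigenspaces to which the counting hypothesis is applied in the uniqueness proof.\<close>

lemma dim_coordinate_subspace:
  fixes A :: "real^'n^'n"
  assumes "invertible A"
  shows "subspace {v. \<forall>i. i \<notin> I \<longrightarrow> (A *v v) $ i = 0}"
    and "dim {v. \<forall>i. i \<notin> I \<longrightarrow> (A *v v) $ i = 0} = card I"
proof -
  let ?E = "{v. \<forall>i. i \<notin> I \<longrightarrow> (A *v v) $ i = 0}"
  let ?B = "{y::real^'n. \<forall>i. i \<notin> I \<longrightarrow> y $ i = 0}"
  show "subspace ?E"
    by (auto simp: subspace_def matrix_vector_right_distrib matrix_vector_mult_scaleR)
  have "?E = (*v) (matrix_inv A) ` ?B"
  proof (intro set_eqI iffI)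
    fix v assume v: "v \<in> ?E"
    have "v = matrix_inv A *v (A *v v)"
      using assms by (simp add: matrix_vector_mul_assoc matrix_inv_left)
    then show "v \<in> (*v) (matrix_inv A) ` ?B" using v by blast
  next
    fix v assume "v \<in> (*v) (matrix_inv A) ` ?B"
    then obtain y where y: "y \<in> ?B" "v = matrix_inv A *v y" by blast
    then have "A *v v = y"
      using assms by (simp add: matrix_vector_mul_assoc matrix_inv_right)
    then show "v \<in> ?E" using y by simp
  qed
  moreover have "inj ((*v) (matrix_inv A))"
    using invertible_matrix_inv[OF assms] invertible_left_inverse matrix_left_invertible_injective by blast
  then have "inj_on ((*v) (matrix_inv A)) (span ?B)" by (rule inj_on_subset) simp
  ultimately have "dim ?E = dim ?B"
    using dim_image_eq[OF matrix_vector_mul_linear, of "matrix_inv A" ?B] by simp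
  then show "dim ?E = card I"
    by (simp add: dim_vec_eq[symmetric] dim_substandard_cart)
qed

text \<open>The counting hypothesis is stated over the natural numbers with denominators cleared, so
  that strictness means a gap of at least 1.\<close>

locale sparse_config =
  fixes X :: "(real^'n) set"
  assumes finite_X: "finite X" and nonempty_X: "X \<noteq> {}" and zero_notin_X: "0 \<notin> X"
    and sparse: "\<And>L. subspace L \<Longrightarrow> 1 \<le> dim L \<Longrightarrow> dim L < CARD('n) \<Longrightarrow>
      card (X \<inter> L) * CARD('n) < dim L * card X"
begin

lemma card_X_pos: "card X > 0"
  using finite_X nonempty_X by (simp add: card_gt_0_iff)

text \<open>A proper span would be a subspace of admissible dimension that contains all the points,
  against \<open>sparse\<close>.\<close>

lemma span_X: "span X = UNIV"
proof (rule ccontr)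
  assume "span X \<noteq> UNIV"
  then have lt: "dim (span X) < CARD('n)"
    by (metis DIM_cart DIM_real dim_eq_full dim_span dim_subset_UNIV le_neq_implies_less mult.right_neutral)
  obtain x where "x \<in> X" "x \<noteq> 0" using nonempty_X zero_notin_X by blast
  then have "dim (span X) \<noteq> 0" by (metis dim_eq_0 dim_span subset_singletonD singletonD empty_iff)
  then have ge: "1 \<le> dim (span X)" by linarith
  have "X \<inter> span X = X" using span_superset by blast
  then have "card X * CARD('n) < dim (span X) * card X"
    using sparse[OF subspace_span ge lt] by (simp only:)
  then show False using lt by (simp add: mult.commute)
qed

lemma inner_inv_pos: "S \<in> spd \<Longrightarrow> x \<in> X \<Longrightarrow> x \<bullet> (matrix_inv S *v x) > 0"
  by (rule spd_inner_pos[OF spd_matrix_inv]) (auto simp: zero_notin_X)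

lemma scatter_spd:
  assumes S: "S \<in> spd"
  shows "scatter X S \<in> spd"
proof -
  let ?w = "\<lambda>x. real CARD('n) / real (card X) / (x \<bullet> (matrix_inv S *v x))"
  have w: "?w x > 0" if "x \<in> X" for x
    using inner_inv_pos[OF S that] card_X_pos by simp
  have sum: "y \<bullet> (scatter X S *v y) = (\<Sum>x\<in>X. ?w x * (x \<bullet> y)^2)" for y
    by (simp add: scatter_def matrix_sum_mult_vec inner_sum_right scaleR_matrix_vector_assoc[symmetric] inner_outer)
  have "y \<bullet> (scatter X S *v y) > 0" if y: "y \<noteq> 0" for y
  proof -
    \<comment> \<open>Otherwise \<open>y\<close> would be orthogonal to the span of
      \<open>X\<close>, hence to itself.\<close>
    have "\<exists>x\<in>X. x \<bullet> y \<noteq> 0"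
    proof (rule ccontr)
      assume "\<not> ?thesis"
      then have "X \<subseteq> {x. y \<bullet> x = 0}" by (auto simp: inner_commute)
      then have "span X \<subseteq> {x. y \<bullet> x = 0}" by (rule span_minimal) (rule subspace_hyperplane)
      then have "y \<bullet> y = 0" using span_X by blast
      then show False using y by simp
    qed
    then obtain x where x: "x \<in> X" "x \<bullet> y \<noteq> 0" by blast
    show ?thesis unfolding sum
    proof (rule sum_pos2[OF finite_X x(1)])
      show "?w x * (x \<bullet> y)^2 > 0" using w[OF x(1)] x(2) by (intro mult_pos_pos) auto
      show "?w z * (z \<bullet> y)^2 \<ge> 0" if "z \<in> X" for z
        using w[OF that] by (intro mult_nonneg_nonneg) (auto simp: less_imp_le)
    qed
  qed
  moreover have "transpose (scatter X S) = scatter X S"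
    by (simp add: scatter_def transpose_sum transpose_scalar)
  ultimately show ?thesis by (simp add: spd_def)
qed

lemma Top_eq_scatter: "Top X S = (1 / trace (scatter X S)) *\<^sub>R scatter X S"
proof -
  define M where "M = (\<Sum>x\<in>X. (1 / (x \<bullet> (matrix_inv S *v x))) *\<^sub>R outer x)"
  have "scatter X S = (real CARD('n) / real (card X)) *\<^sub>R M"
    by (simp add: scatter_def M_def scaleR_sum_right)
  then show ?thesis
    using card_X_pos by (simp add: Top_def M_def[symmetric] trace_scaleR)
qed

text \<open>The scale contributes \<open>- ln c\<close> through the average over the points and
  \<open>ln c\<close> through the determinant term.\<close>

lemma Fobj_scaleR:
  assumes S: "S \<in> spd" and c: "c > 0"
  shows "Fobj X (c *\<^sub>R S) = Fobj X S"
proof -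
  have "ln (x \<bullet> (matrix_inv (c *\<^sub>R S) *v x)) = ln (x \<bullet> (matrix_inv S *v x)) - ln c" if "x \<in> X" for x
    using inner_inv_pos[OF S that] c spd_invertible[OF S]
    by (simp add: matrix_inv_scaleR scaleR_matrix_vector_assoc[symmetric] ln_div)
  then have "(\<Sum>x\<in>X. ln (x \<bullet> (matrix_inv (c *\<^sub>R S) *v x)))
      = (\<Sum>x\<in>X. ln (x \<bullet> (matrix_inv S *v x))) - real (card X) * ln c"
    by (simp add: sum_subtractf)
  moreover have "ln (det (c *\<^sub>R S)) = real CARD('n) * ln c + ln (det S)"
    using spd_det_pos[OF S] c by (simp add: det_scaleR ln_mult_pos ln_realpow)
  ultimately show ?thesis
    unfolding Fobj_def using card_X_pos by (simp only:) (simp add: field_simps)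
qed

lemma trace_mult_scatter:
  "trace (A ** scatter X S) = real CARD('n) / real (card X) * (\<Sum>x\<in>X. (x \<bullet> (A *v x)) / (x \<bullet> (matrix_inv S *v x)))"
  unfolding scatter_def matrix_mult_sum_right scaleR_matrix_mult_right trace_sum trace_scaleR trace_mult_outer
    sum_distrib_left
  by simp

lemma trace_inv_scatter:
  assumes S: "S \<in> spd"
  shows "trace (matrix_inv S ** scatter X S) = real CARD('n)"
proof -
  have "(\<Sum>x\<in>X. (x \<bullet> (matrix_inv S *v x)) / (x \<bullet> (matrix_inv S *v x))) = real (card X)"
    using inner_inv_pos[OF S] by (simp add: less_imp_neq[symmetric])
  then show ?thesis using card_X_pos by (simp add: trace_mult_scatter)
qed

text \<open>Both summands of the objective decrease separately: the point terms because the ratios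
  of new to old forms average to 1, the determinant term because the relative eigenvalues
  do.\<close>

lemma
  assumes S: "S \<in> spd"
  shows Fobj_scatter_le: "Fobj X (scatter X S) \<le> Fobj X S"
    and Fobj_scatter_eq: "Fobj X (scatter X S) = Fobj X S \<Longrightarrow> scatter X S = S"
proof -
  define M where "M = scatter X S"
  have M: "M \<in> spd" unfolding M_def by (rule scatter_spd[OF S])
  let ?q = "\<lambda>x. x \<bullet> (matrix_inv S *v x)" and ?r = "\<lambda>x. x \<bullet> (matrix_inv M *v x)"
  \<comment> \<open>Expanding only the second factor of \<open>matrix_inv M ** M\<close> by the
    definition of \<open>scatter\<close> turns a trivial trace into the statement that the ratios
    average to 1.\<close>
  have "real CARD('n) = trace (matrix_inv M ** M)"
    by (simp add: matrix_inv_left[OF spd_invertible[OF M]] trace_I)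
  also have "\<dots> = real CARD('n) / real (card X) * (\<Sum>x\<in>X. ?r x / ?q x)"
    unfolding M_def by (rule trace_mult_scatter)
  finally have sum: "(\<Sum>x\<in>X. ?r x / ?q x) = real (card X)"
    using card_X_pos by (simp add: field_simps)
  have "ln (?r x) \<le> ln (?q x) + (?r x / ?q x - 1)" if "x \<in> X" for x
    using ln_le_minus_one[of "?r x / ?q x"] inner_inv_pos[OF S that] inner_inv_pos[OF M that] by (simp add: ln_div)
  then have "(\<Sum>x\<in>X. ln (?r x)) \<le> (\<Sum>x\<in>X. ln (?q x) + (?r x / ?q x - 1))"
    by (rule sum_mono)
  also have "\<dots> = (\<Sum>x\<in>X. ln (?q x))" by (simp add: sum.distrib sum_subtractf sum)
  finally have 1: "1 / real (card X) * (\<Sum>x\<in>X. ln (?r x)) \<le> 1 / real (card X) * (\<Sum>x\<in>X. ln (?q x))"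
    by (intro mult_left_mono) auto
  have tr: "trace (matrix_inv S ** M) = real CARD('n)"
    unfolding M_def by (rule trace_inv_scatter[OF S])
  have le: "ln (det M) \<le> ln (det S)"
    using ln_det_le_trace(1)[OF S M] tr by simp
  then have 2: "1 / real CARD('n) * ln (det M) \<le> 1 / real CARD('n) * ln (det S)"
    by (intro mult_left_mono) auto
  show "Fobj X (scatter X S) \<le> Fobj X S"
    unfolding M_def[symmetric] Fobj_def using 1 2 by (rule add_mono)
  \<comment> \<open>Neither summand increases, so equality of the sums forces equality of the
    determinants, which is the equality case of \<open>ln_det_le_trace\<close>.\<close>
  assume "Fobj X (scatter X S) = Fobj X S"
  then have "1 / real CARD('n) * ln (det M) = 1 / real CARD('n) * ln (det S)"
    unfolding M_def[symmetric] Fobj_def using 1 2 by linarith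
  then have "ln (det M) = ln (det S) + trace (matrix_inv S ** M) - real CARD('n)" by (simp add: tr)
  then show "scatter X S = S" unfolding M_def[symmetric] by (rule ln_det_le_trace(2)[OF S M])
qed

lemma Top_spd: "S \<in> spd \<Longrightarrow> Top X S \<in> spd"
  using spd_trace_pos[OF scatter_spd, of S] by (simp only: Top_eq_scatter) (simp add: spd_scaleR scatter_spd)

lemma trace_Top: "S \<in> spd \<Longrightarrow> trace (Top X S) = 1"
  unfolding Top_eq_scatter using spd_trace_pos[OF scatter_spd, of S] by (simp add: trace_scaleR)

lemma Fobj_Top: "S \<in> spd \<Longrightarrow> Fobj X (Top X S) = Fobj X (scatter X S)"
  using spd_trace_pos[OF scatter_spd, of S] by (simp only: Top_eq_scatter) (simp add: Fobj_scaleR scatter_spd)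

text \<open>The difference of the objectives at \<open>S'\<close> and \<open>S\<close> is an average
  of Jensen defects. Assuming only \<open>\<le>\<close> makes one statement yield both minimality
  and uniqueness.\<close>

lemma scatter_fixed_point_strict_minimizer:
  assumes S: "S \<in> spd" and S': "S' \<in> spd" and fixed: "scatter X S = S"
    and tr: "trace S' = trace S" and le: "Fobj X S' \<le> Fobj X S"
  shows "S' = S"
proof (rule ccontr)
  assume neq: "S' \<noteq> S"
  obtain C :: "real^'n^'n" and l where C: "invertible C" "\<forall>i. l i > 0" "S = C ** transpose C" "S' = C ** diagm l ** transpose C"
    using spd_simultaneous_diagonalization[OF S S'] .
  define y where "y x = matrix_inv C *v x" for x
  define q where "q x = x \<bullet> (matrix_inv S *v x)" for x
  have S1: "S = C ** diagm (\<lambda>i. 1) ** transpose C" by (simp add: C(3) diagm_const)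
  have q: "q x = (\<Sum>i\<in>UNIV. (y x $ i)^2)" for x
    unfolding q_def S1 by (subst inner_inv_congruence_diagm) (simp_all add: C y_def)
  have q': "x \<bullet> (matrix_inv S' *v x) = (\<Sum>i\<in>UNIV. (y x $ i)^2 / l i)" for x
    unfolding C(4) y_def by (rule inner_inv_congruence_diagm[OF C(1,2)])
  have qpos: "q x > 0" if "x \<in> X" for x unfolding q_def by (rule inner_inv_pos[OF S that])
  \<comment> \<open>For each point these are weights of total 1: the shares of the coordinates in
    \<open>q x\<close>. They are the weights for Jensen's inequality.\<close>
  define p where "p x i = (y x $ i)^2 / q x" for x i
  have pnn: "p x i \<ge> 0" if "x \<in> X" for x i using qpos[OF that] by (simp add: p_def)
  have psum: "(\<Sum>i\<in>UNIV. p x i) = 1" if "x \<in> X" for x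
    using qpos[OF that] by (simp add: p_def sum_divide_distrib[symmetric] q[symmetric])
  \<comment> \<open>The fixed-point equation, transported by \<open>matrix_inv C\<close>, writes the
    identity as a weighted sum of outer products; its diagonal entries say that all coordinates
    receive the same total weight.\<close>
  have pX: "(\<Sum>x\<in>X. p x i) = real (card X) / real CARD('n)" for i
  proof -
    have "mat 1 = matrix_inv C ** S ** transpose (matrix_inv C)"
      unfolding S1 congruence_cancel[OF C(1)] by (simp add: diagm_const)
    also have "\<dots> = matrix_inv C ** scatter X S ** transpose (matrix_inv C)"
      by (simp only: fixed)
    also have "\<dots> = (\<Sum>x\<in>X. (real CARD('n) / real (card X) / q x) *\<^sub>R (matrix_inv C ** outer x ** transpose (matrix_inv C)))"
      unfolding scatter_def q_def matrix_mult_sum_right matrix_mult_sum_left scaleR_matrix_mult_right scaleR_matrix_mult_left ..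
    also have "\<dots> = (\<Sum>x\<in>X. (real CARD('n) / real (card X) / q x) *\<^sub>R outer (y x))"
      unfolding congruence_outer y_def ..
    finally have "(mat 1 :: real^'n^'n) $ i $ i = (\<Sum>x\<in>X. real CARD('n) / real (card X) / q x * (y x $ i)^2)"
      by (simp add: outer_def power2_eq_square)
    also have "\<dots> = real CARD('n) / real (card X) * (\<Sum>x\<in>X. p x i)"
      by (simp add: p_def sum_distrib_left)
    finally show ?thesis using card_X_pos by (simp add: mat_def field_simps)
  qed
  define a where "a i = 1 / l i" for i
  have a: "a i > 0" for i using C(2) by (simp add: a_def)
  have lna: "ln (a i) = - ln (l i)" for i
    unfolding a_def using C(2) by (metis inverse_eq_divide ln_inverse)
  have qq: "ln (x \<bullet> (matrix_inv S' *v x)) = ln (q x) + ln (\<Sum>i\<in>UNIV. p x i * a i)" if "x \<in> X" for x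
  proof -
    have "x \<bullet> (matrix_inv S' *v x) = q x * (\<Sum>i\<in>UNIV. p x i * a i)"
      using qpos[OF that] unfolding q' by (simp add: p_def a_def sum_distrib_left)
    moreover have "x \<bullet> (matrix_inv S' *v x) > 0" by (rule inner_inv_pos[OF S' that])
    ultimately show ?thesis using qpos[OF that] by (simp add: ln_mult_pos zero_less_mult_iff)
  qed
  \<comment> \<open>The Jensen defect of \<open>ln\<close> at the point \<open>x\<close>. By
    \<open>pX\<close>, the subtracted averages add up to exactly the change of the determinant
    term.\<close>
  define J where "J x = ln (\<Sum>i\<in>UNIV. p x i * a i) - (\<Sum>i\<in>UNIV. p x i * ln (a i))" for x
  have J: "J x \<ge> 0" if "x \<in> X" for x
    using ln_jensen(1)[of "p x" a] pnn psum a that by (simp add: J_def)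
  have "(\<Sum>x\<in>X. \<Sum>i\<in>UNIV. p x i * ln (a i)) = (\<Sum>i\<in>UNIV. (\<Sum>x\<in>X. p x i) * ln (a i))"
    by (subst sum.swap) (simp add: sum_distrib_right)
  also have "\<dots> = - (real (card X) / real CARD('n)) * (\<Sum>i\<in>UNIV. ln (l i))"
    by (simp add: pX lna sum_distrib_left sum_negf)
  finally have sump: "(\<Sum>x\<in>X. \<Sum>i\<in>UNIV. p x i * ln (a i))
      = - (real (card X) / real CARD('n)) * (\<Sum>i\<in>UNIV. ln (l i))" .
  have "(\<Sum>x\<in>X. J x) = (\<Sum>x\<in>X. ln (x \<bullet> (matrix_inv S' *v x)) - ln (q x) - (\<Sum>i\<in>UNIV. p x i * ln (a i)))"
    by (intro sum.cong refl) (simp add: J_def qq)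
  then have "(\<Sum>x\<in>X. J x) = (\<Sum>x\<in>X. ln (x \<bullet> (matrix_inv S' *v x))) - (\<Sum>x\<in>X. ln (q x))
      + real (card X) / real CARD('n) * (\<Sum>i\<in>UNIV. ln (l i))"
    by (simp only: sum_subtractf sump)
  moreover have "ln (det S') = ln (det S) + (\<Sum>i\<in>UNIV. ln (l i))"
    unfolding C(3,4) by (rule ln_det_congruence_diagm[OF C(1,2)])
  moreover have "real (card X) * (Fobj X S' - Fobj X S)
      = (\<Sum>x\<in>X. ln (x \<bullet> (matrix_inv S' *v x))) - (\<Sum>x\<in>X. ln (q x))
        + real (card X) / real CARD('n) * (ln (det S') - ln (det S))"
    using card_X_pos by (simp add: Fobj_def q_def right_diff_distrib distrib_left)
  ultimately have "(\<Sum>x\<in>X. J x) = real (card X) * (Fobj X S' - Fobj X S)"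
    by simp
  also have "\<dots> \<le> 0" using le by (simp add: mult_nonneg_nonpos)
  finally have "(\<Sum>x\<in>X. J x) = 0" using J by (simp add: sum_nonneg order_antisym)
  then have J0: "J x = 0" if "x \<in> X" for x
    using J that finite_X by (simp add: sum_nonneg_eq_0_iff)
  \<comment> \<open>The equality case of Jensen: \<open>l\<close> is constant on the nonzero
    coordinates of each point.\<close>
  have supp: "l i = l j" if x: "x \<in> X" and ij: "y x $ i \<noteq> 0" "y x $ j \<noteq> 0" for x i j
  proof -
    have "a k = (\<Sum>i\<in>UNIV. p x i * a i)" if "y x $ k \<noteq> 0" for k
      using J0[OF x] pnn[OF x] psum[OF x] a qpos[OF x] that
      by (intro ln_jensen(2)) (auto simp: J_def p_def)
    then have "a i = a j" using ij by metis
    then show ?thesis by (simp add: a_def)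
  qed
  \<comment> \<open>If all \<open>l i\<close> agreed, \<open>S'\<close> would be a multiple of
    \<open>S\<close>, hence equal to it by the trace condition; \<open>undefined\<close> is merely
    some fixed index.\<close>
  obtain i0 j0 where ij: "l i0 \<noteq> l j0"
  proof (rule ccontr)
    assume "\<not> thesis"
    then have const: "l i = l undefined" for i using that by blast
    then have "diagm l = l undefined *\<^sub>R mat 1" by (metis diagm_const ext)
    then have "S' = l undefined *\<^sub>R S" by (simp add: C scaleR_matrix_mult_right scaleR_matrix_mult_left)
    then show False using tr neq spd_trace_pos[OF S] by (simp add: trace_scaleR)
  qed
  \<comment> \<open>By \<open>supp\<close>, each point has its nonzero coordinates all inside
    \<open>I\<close> or all outside. The two coordinate subspaces thus cover \<open>X\<close>, while
    their dimensions add up to the full one, so the two strict counts together miss a point.\<close>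
  define I where "I = {i. l i = l i0}"
  let ?E = "\<lambda>I. {v. \<forall>i. i \<notin> I \<longrightarrow> (matrix_inv C *v v) $ i = 0}"
  note dimE = dim_coordinate_subspace[OF invertible_matrix_inv[OF C(1)]]
  have "i0 \<in> I" "j0 \<in> - I" using ij by (auto simp: I_def)
  then have c1: "1 \<le> card I" "1 \<le> card (- I)" by (auto simp: Suc_le_eq card_gt_0_iff)
  have c2: "card I + card (- I) = CARD('n)"
    by (metis Compl_partition Compl_disjoint card_Un_disjoint finite)
  have "card (X \<inter> ?E I) * CARD('n) < card I * card X"
    using sparse[OF dimE(1), of I] c1 c2 by (simp add: dimE(2))
  moreover have "card (X \<inter> ?E (- I)) * CARD('n) < card (- I) * card X"
    using sparse[OF dimE(1), of "- I"] c1 c2 by (simp only: dimE(2))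
  ultimately have "(card (X \<inter> ?E I) + card (X \<inter> ?E (- I))) * CARD('n) < (card I + card (- I)) * card X"
    by (simp add: add_mult_distrib)
  then have "card (X \<inter> ?E I) + card (X \<inter> ?E (- I)) < card X"
    by (simp only: c2) simp
  moreover have "(X \<inter> ?E I) \<union> (X \<inter> ?E (- I)) = X"
  proof -
    have "x \<in> ?E I \<union> ?E (- I)" if x: "x \<in> X" for x
    proof (cases "\<exists>i\<in>I. y x $ i \<noteq> 0")
      case True
      then obtain i where i: "l i = l i0" "y x $ i \<noteq> 0" by (auto simp: I_def)
      have "y x $ j = 0" if "j \<notin> I" for j
      proof (rule ccontr)
        assume "y x $ j \<noteq> 0"
        then have "l i = l j" by (rule supp[OF x i(2)])
        then show False using that i(1) by (simp add: I_def)
      qed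
      then show ?thesis by (simp add: y_def)
    next
      case False
      then show ?thesis by (simp add: y_def)
    qed
    then show ?thesis by blast
  qed
  then have "card X \<le> card (X \<inter> ?E I) + card (X \<inter> ?E (- I))"
    using card_Un_le[of "X \<inter> ?E I" "X \<inter> ?E (- I)"] by (simp only:)
  ultimately show False by simp
qed

end

subsection \<open>Continuity and compactness\<close>

lemma tendsto_det:
  fixes f :: "'a \<Rightarrow> real^'n^'n"
  assumes "(f \<longlongrightarrow> A) F"
  shows "((\<lambda>x. det (f x)) \<longlongrightarrow> det A) F"
  unfolding det_def by (intro tendsto_intros assms)

lemma tendsto_trace:
  fixes f :: "'a \<Rightarrow> real^'n^'n"
  assumes "(f \<longlongrightarrow> A) F"
  shows "((\<lambda>x. trace (f x)) \<longlongrightarrow> trace A) F"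
  unfolding trace_def by (intro tendsto_intros assms)

lemma tendsto_transpose:
  fixes f :: "'a \<Rightarrow> real^'n^'n"
  assumes "(f \<longlongrightarrow> A) F"
  shows "((\<lambda>x. transpose (f x)) \<longlongrightarrow> transpose A) F"
  unfolding transpose_def by (intro tendsto_intros assms)

lemma tendsto_matrix_mult:
  fixes f g :: "'a \<Rightarrow> real^'n^'n"
  assumes "(f \<longlongrightarrow> A) F" "(g \<longlongrightarrow> B) F"
  shows "((\<lambda>x. f x ** g x) \<longlongrightarrow> A ** B) F"
  unfolding matrix_matrix_mult_def by (intro tendsto_intros assms)

lemma tendsto_matrix_vector_mult:
  fixes f :: "'a \<Rightarrow> real^'n^'n"
  assumes "(f \<longlongrightarrow> A) F"
  shows "((\<lambda>x. f x *v y) \<longlongrightarrow> A *v y) F"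
  unfolding matrix_vector_mult_def by (intro tendsto_intros assms)

text \<open>Cramer's rule: the entries of the inverse are quotients of determinants, from which
  continuity of the inverse follows.\<close>

lemma matrix_inv_component:
  fixes A :: "real^'n^'n"
  assumes "invertible A"
  shows "matrix_inv A $ k $ m = det (\<chi> i j. if j = k then axis m 1 $ i else A $ i $ j) / det A"
proof -
  have "A *v (matrix_inv A *v axis m 1) = axis m 1"
    using assms by (simp add: matrix_vector_mul_assoc matrix_inv_right)
  moreover have "det A \<noteq> 0" using assms by (simp add: invertible_det_nz)
  ultimately have "matrix_inv A *v axis m 1 = (\<chi> k. det (\<chi> i j. if j = k then axis m 1 $ i else A $ i $ j) / det A)"
    using cramer by blast
  then have "(matrix_inv A *v axis m 1) $ k = det (\<chi> i j. if j = k then axis m 1 $ i else A $ i $ j) / det A"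
    by simp
  then show ?thesis by (simp add: matrix_vector_mult_basis column_def)
qed

lemma tendsto_matrix_inv:
  fixes f :: "'a \<Rightarrow> real^'n^'n"
  assumes f: "(f \<longlongrightarrow> A) F" and A: "invertible A"
  shows "((\<lambda>x. matrix_inv (f x)) \<longlongrightarrow> matrix_inv A) F"
proof (rule vec_tendstoI, rule vec_tendstoI)
  fix k m
  have det: "det A \<noteq> 0" using A by (simp add: invertible_det_nz)
  have "eventually (\<lambda>x. det (f x) \<in> - {0}) F"
    by (rule topological_tendstoD[OF tendsto_det[OF f]]) (use det in auto)
  then have ev: "eventually (\<lambda>x. det (\<chi> i j. if j = k then axis m 1 $ i else f x $ i $ j) / det (f x)
      = matrix_inv (f x) $ k $ m) F"
    by eventually_elim (simp add: matrix_inv_component invertible_det_nz)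
  have comp: "((\<lambda>x. if j = k then axis m 1 $ i else f x $ i $ j) \<longlongrightarrow> (if j = k then axis m 1 $ i else A $ i $ j)) F" for i j
    using f by (auto intro!: tendsto_intros)
  have "((\<lambda>x. det (\<chi> i j. if j = k then axis m 1 $ i else f x $ i $ j) / det (f x)) \<longlongrightarrow>
      det (\<chi> i j. if j = k then axis m 1 $ i else A $ i $ j) / det A) F"
    by (intro tendsto_divide tendsto_det f det tendsto_vec_lambda comp)
  then show "((\<lambda>x. matrix_inv (f x) $ k $ m) \<longlongrightarrow> matrix_inv A $ k $ m) F"
    using tendsto_cong[OF ev] by (simp add: matrix_inv_component[OF A])
qed

section \<open>Continuity of the objective and of the iteration map\<close>

context sparse_config
begin

lemma tendsto_inner_inv:
  assumes "(f \<longlongrightarrow> S) F" "S \<in> spd"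
  shows "((\<lambda>k. x \<bullet> (matrix_inv (f k) *v x)) \<longlongrightarrow> x \<bullet> (matrix_inv S *v x)) F"
  by (intro tendsto_intros tendsto_matrix_vector_mult tendsto_matrix_inv assms spd_invertible)

lemma tendsto_Fobj:
  assumes "(f \<longlongrightarrow> S) F" "S \<in> spd"
  shows "((\<lambda>k. Fobj X (f k)) \<longlongrightarrow> Fobj X S) F"
  unfolding Fobj_def
  using inner_inv_pos[OF assms(2)] spd_det_pos[OF assms(2)]
  by (intro tendsto_intros tendsto_inner_inv tendsto_det assms) (auto simp: less_imp_neq[symmetric])

lemma tendsto_Top:
  assumes "(f \<longlongrightarrow> S) F" "S \<in> spd"
  shows "((\<lambda>k. Top X (f k)) \<longlongrightarrow> Top X S) F"
proof -
  have sc: "((\<lambda>k. scatter X (f k)) \<longlongrightarrow> scatter X S) F"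
    unfolding scatter_def
    using inner_inv_pos[OF assms(2)]
    by (intro tendsto_intros tendsto_inner_inv assms) (auto simp: less_imp_neq[symmetric])
  have "trace (scatter X S) \<noteq> 0" using spd_trace_pos[OF scatter_spd[OF assms(2)]] by simp
  then show ?thesis unfolding Top_eq_scatter by (intro tendsto_intros tendsto_trace sc)
qed

end

text \<open>The conditions are closed, and semidefiniteness with trace 1 bounds all entries by 1.
  For positive \<open>e\<close> the determinant bound keeps the set away from the singular
  matrices.\<close>

lemma compact_psd_det_ge:
  "compact {G::real^'n^'n. transpose G = G \<and> (\<forall>x. 0 \<le> x \<bullet> (G *v x)) \<and> trace G = 1 \<and> e \<le> det G}" (is "compact ?C")
proof -
  have "closed ?C"
    unfolding closed_sequential_limits
  proof (intro allI impI)
    fix G and A :: "real^'n^'n" assume "(\<forall>n. G n \<in> ?C) \<and> G \<longlonglongrightarrow> A"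
    then have G: "\<forall>n. G n \<in> ?C" and lim: "G \<longlonglongrightarrow> A" by auto
    have "(\<lambda>n. transpose (G n)) \<longlonglongrightarrow> transpose A" by (rule tendsto_transpose[OF lim])
    then have "transpose A = A" using G lim by (simp add: LIMSEQ_unique)
    moreover have "0 \<le> x \<bullet> (A *v x)" for x
      by (rule LIMSEQ_le_const[OF tendsto_inner[OF tendsto_const tendsto_matrix_vector_mult[OF lim]]])
        (use G in auto)
    moreover have "trace A = 1"
      using tendsto_trace[OF lim] G by (simp add: LIMSEQ_const_iff)
    moreover have "e \<le> det A"
      by (rule LIMSEQ_le_const[OF tendsto_det[OF lim]]) (use G in auto)
    ultimately show "A \<in> ?C" by simp
  qed
  moreover have "bounded ?C"
  proof -
    have "norm G \<le> real CARD('n) * real CARD('n)" if G: "G \<in> ?C" for G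
    proof -
      have d: "0 \<le> G $ i $ i" for i using G by (simp add: diag_eq_inner)
      have d1: "G $ i $ i \<le> 1" for i
      proof -
        have "G $ i $ i \<le> trace G"
          unfolding trace_def using d by (intro member_le_sum) auto
        then show ?thesis using G by simp
      qed
      have "\<bar>G $ i $ j\<bar> \<le> 1" for i j
      proof -
        have "transpose G $ j $ i = G $ j $ i" using G by simp
        then have sym: "G $ i $ j = G $ j $ i" by (simp add: transpose_def)
        have e: "axis k 1 \<bullet> (G *v axis l 1) = G $ k $ l" for k l
          by (simp add: matrix_vector_mult_basis column_def inner_axis')
        \<comment> \<open>The values 1 and -1 of \<open>s\<close> bound twice the absolute
          off-diagonal entry by the sum of two diagonal entries, hence by 2.\<close>
        have "0 \<le> (axis i 1 + s *\<^sub>R axis j 1) \<bullet> (G *v (axis i 1 + s *\<^sub>R axis j 1))" for s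
          using G by blast
        then have "0 \<le> G $ i $ i + s * G $ i $ j + s * (G $ i $ j + s * G $ j $ j)" for s
          by (simp add: matrix_vector_right_distrib matrix_vector_mult_scaleR inner_add_left inner_add_right e sym)
        from this[of 1] this[of "-1"] show ?thesis using d1[of i] d1[of j] by (simp add: abs_le_iff)
      qed
      then have "(\<Sum>j\<in>UNIV. norm (G $ i $ j)) \<le> real CARD('n)" for i
        using sum_bounded_above[of UNIV "\<lambda>j. norm (G $ i $ j)" 1] by simp
      moreover have "norm (G $ i) \<le> (\<Sum>j\<in>UNIV. norm (G $ i $ j))" for i
        unfolding norm_vec_def by (rule L2_set_le_sum) simp
      ultimately have "norm (G $ i) \<le> real CARD('n)" for i
        by (rule order_trans[rotated])
      then have "(\<Sum>i\<in>UNIV. norm (G $ i)) \<le> real CARD('n) * real CARD('n)"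
        using sum_bounded_above[of UNIV "\<lambda>i. norm (G $ i)" "real CARD('n)"] by simp
      moreover have "norm G \<le> (\<Sum>i\<in>UNIV. norm (G $ i))"
        unfolding norm_vec_def[of G] by (rule L2_set_le_sum) simp
      ultimately show ?thesis by linarith
    qed
    then show ?thesis by (rule boundedI)
  qed
  ultimately show ?thesis by (simp add: compact_eq_bounded_closed)
qed

subsection \<open>Compactness of sublevel sets\<close>

text \<open>At each stage a point of least \<open>g\<close> outside the current span is added; fewer
  than \<open>CARD('n)\<close> vectors cannot span, so candidates remain.\<close>

lemma greedy_basis_exists:
  fixes X :: "(real^'n) set" and g :: "real^'n \<Rightarrow> real"
  assumes fin: "finite X" and sp: "span X = UNIV"
  obtains b :: "nat \<Rightarrow> real^'n" where
    "\<And>i. i < CARD('n) \<Longrightarrow> b i \<in> X - span (b ` {..<i})"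
    "\<And>i x. i < CARD('n) \<Longrightarrow> x \<in> X - span (b ` {..<i}) \<Longrightarrow> g (b i) \<le> g x"
proof -
  have "\<exists>b :: nat \<Rightarrow> real^'n. \<forall>i<m. b i \<in> X - span (b ` {..<i}) \<and> (\<forall>x\<in>X - span (b ` {..<i}). g (b i) \<le> g x)"
    if "m \<le> CARD('n)" for m
    using that
  proof (induction m)
    case 0
    then show ?case by simp
  next
    case (Suc m)
    then obtain b :: "nat \<Rightarrow> real^'n" where b: "\<And>i. i < m \<Longrightarrow> b i \<in> X - span (b ` {..<i}) \<and>
        (\<forall>x\<in>X - span (b ` {..<i}). g (b i) \<le> g x)" by auto
    let ?Z = "X - span (b ` {..<m})"
    have "?Z \<noteq> {}"
    proof
      assume "?Z = {}"
      then have "span X \<subseteq> span (b ` {..<m})" by (intro span_minimal) auto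
      then have "dim (b ` {..<m}) = CARD('n)" using sp by (metis dim_UNIV dim_span DIM_cart DIM_real mult.right_neutral top.extremum_uniqueI)
      moreover have "dim (b ` {..<m}) \<le> m"
        using dim_le_card'[of "b ` {..<m}"] card_image_le[of "{..<m}" b] by simp
      ultimately show False using Suc.prems by simp
    qed
    then obtain z where z: "z \<in> ?Z" "\<And>x. x \<in> ?Z \<Longrightarrow> g z \<le> g x"
      using arg_min_if_finite[of ?Z g] fin by (metis finite_Diff not_le)
    \<comment> \<open>Stage \<open>i\<close> looks only at the vectors before \<open>i\<close>, so
      redefining \<open>b\<close> at \<open>m\<close> leaves all stages up to \<open>m\<close>
      unchanged.\<close>
    have eq: "(b(m := z)) ` {..<i} = b ` {..<i}" if "i \<le> m" for i
      using that by (intro image_cong) auto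
    show ?case
    proof (intro exI[of _ "b(m := z)"] allI impI)
      fix i assume "i < Suc m"
      then consider "i < m" | "i = m" by linarith
      then show "(b(m := z)) i \<in> X - span ((b(m := z)) ` {..<i}) \<and>
          (\<forall>x\<in>X - span ((b(m := z)) ` {..<i}). g ((b(m := z)) i) \<le> g x)"
        using b z by cases (simp_all add: eq del: fun_upd_apply, simp_all)
    qed
  qed
  from this[of "CARD('n)"] that show ?thesis by blast
qed

context sparse_config
begin

text \<open>With \<open>N i\<close> the number of points in the span of the first \<open>i\<close> greedy basis vectors, sparsity and
  integrality give \<open>N i / N - i / D \<le> - 1 / (N D)\<close> for \<open>0 < i < D\<close>; summation by parts turns this into a
  gain proportional to the spread of \<open>g\<close> on the basis.\<close>
lemma greedy_basis_gain:
  fixes g :: "real^'n \<Rightarrow> real"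
  obtains b :: "nat \<Rightarrow> real^'n" where "b ` {..<CARD('n)} \<subseteq> X" "span (b ` {..<CARD('n)}) = UNIV"
    "\<forall>x\<in>X. g (b 0) \<le> g x" "\<forall>i<CARD('n). g (b i) \<le> g (b (CARD('n) - 1))"
    "real (card X) / real CARD('n) * (\<Sum>i<CARD('n). g (b i))
        + (g (b (CARD('n) - 1)) - g (b 0)) / real CARD('n) \<le> (\<Sum>x\<in>X. g x)"
proof -
  let ?D = "CARD('n)"
  obtain b :: "nat \<Rightarrow> real^'n" where
    b: "\<And>i. i < ?D \<Longrightarrow> b i \<in> X - span (b ` {..<i})" and
    bmin: "\<And>i x. i < ?D \<Longrightarrow> x \<in> X - span (b ` {..<i}) \<Longrightarrow> g (b i) \<le> g x"
    using greedy_basis_exists[OF finite_X span_X] by metis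
  define L where "L i = span (b ` {..<i})" for i
  define N where "N i = card (X \<inter> L i)" for i
  have img: "b ` {..<Suc i} = insert (b i) (b ` {..<i})" for i
    by (simp add: lessThan_Suc)
  have ind: "independent (b ` {..<i}) \<and> card (b ` {..<i}) = i" if "i \<le> ?D" for i
    using that
  proof (induction i)
    case (Suc i)
    have nb: "b i \<notin> span (b ` {..<i})" using b[of i] Suc.prems by simp
    then have "b i \<notin> b ` {..<i}" by (rule contra_subsetD[OF span_superset])
    with nb show ?case using Suc by (simp add: img independent_insert)
  qed (simp add: independent_empty)
  have dimL: "dim (L i) = i" if "i \<le> ?D" for i
    using ind[OF that] by (simp add: L_def dim_eq_card_independent)
  have LD: "L ?D = UNIV"
    using dimL[of ?D] unfolding L_def
    by (metis DIM_cart DIM_real dim_eq_full dim_span mult.right_neutral order_refl span_span)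
  have mono: "L i \<subseteq> L (Suc i)" for i
    unfolding L_def by (intro span_mono image_mono) auto
  have N0: "N 0 = 0" using zero_notin_X by (simp add: N_def L_def)
  have ND: "N ?D = card X" by (simp add: N_def LD)
  \<comment> \<open>The next basis vector was already a candidate one stage earlier, because the
    spans increase.\<close>
  have bstep: "g (b i) \<le> g (b (Suc i))" if "Suc i < ?D" for i
    using b[OF that] bmin[of i "b (Suc i)"] mono[of i] that by (auto simp: L_def)
  have bmono: "g (b i) \<le> g (b j)" if "i \<le> j" "j < ?D" for i j
    using that by (induction j rule: dec_induct) (auto intro: order_trans bstep)
  \<comment> \<open>The points are grouped by the first span that contains them; those new in
    \<open>L (Suc i)\<close> were candidates at stage \<open>i\<close>, so \<open>g\<close> is at
    least \<open>g (b i)\<close> there.\<close>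
  have sum_ge: "(\<Sum>i<m. (real (N (Suc i)) - real (N i)) * g (b i)) \<le> (\<Sum>x\<in>X \<inter> L m. g x)" if "m \<le> ?D" for m
    using that
  proof (induction m)
    case 0
    have "X \<inter> L 0 = {}" using zero_notin_X by (simp add: L_def)
    then show ?case by simp
  next
    case (Suc m)
    let ?Z = "X \<inter> L (Suc m) - X \<inter> L m"
    have split: "X \<inter> L (Suc m) = (X \<inter> L m) \<union> ?Z" using mono[of m] by blast
    have "(\<Sum>x\<in>X \<inter> L (Suc m). g x) = (\<Sum>x\<in>X \<inter> L m. g x) + (\<Sum>x\<in>?Z. g x)"
      by (subst split, rule sum.union_disjoint) (use finite_X in auto)
    moreover have "card ?Z = N (Suc m) - N m"
      unfolding N_def using mono[of m] finite_X by (intro card_Diff_subset) auto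
    then have "real (card ?Z) = real (N (Suc m)) - real (N m)"
      unfolding N_def using mono[of m] finite_X by (subst of_nat_diff[symmetric]) (auto intro!: card_mono)
    moreover have "real (card ?Z) * g (b m) \<le> (\<Sum>x\<in>?Z. g x)"
      using Suc.prems by (intro sum_bounded_below bmin) (auto simp: L_def)
    ultimately show ?case using Suc by simp
  qed
  \<comment> \<open>The excess of the number of points in \<open>L i\<close> over the proportional
    share. It vanishes at both ends and lies at or below \<open>- (1 / real ?D)\<close> strictly
    between them.\<close>
  define c where "c i = real (N i) - real i * (real (card X) / real ?D)" for i
  have c_le: "c i \<le> - (1 / real ?D)" if "0 < i" "i < ?D" for i
  proof -
    have "card (X \<inter> L i) * ?D < dim (L i) * card X"
      using that dimL[of i] by (intro sparse) (auto simp: L_def)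
    then have "N i * ?D + 1 \<le> i * card X" using dimL[of i] that by (simp add: N_def)
    then have "real (N i * ?D + 1) \<le> real (i * card X)" by (simp only: of_nat_le_iff)
    then have "real (N i * ?D + 1) / real ?D \<le> real (i * card X) / real ?D" by (rule divide_right_mono) simp
    then show ?thesis by (simp add: c_def add_divide_distrib)
  qed
  have cD: "c ?D = 0" by (simp add: c_def ND)
  have c0: "c 0 = 0" by (simp add: c_def N0)
  \<comment> \<open>Summation by parts as an induction that carries the boundary term; for the last
    index that term drops out because \<open>c ?D = 0\<close>.\<close>
  have abel: "(g (b m) - g (b 0)) / real ?D \<le> (\<Sum>i<Suc m. (c (Suc i) - c i) * g (b i)) - c (Suc m) * g (b m)"
    if "m < ?D" for m
    using that
  proof (induction m)
    case 0
    then show ?case by (simp add: c0)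
  next
    case (Suc m)
    have "1 / real ?D * (g (b (Suc m)) - g (b m)) \<le> - c (Suc m) * (g (b (Suc m)) - g (b m))"
      using c_le[of "Suc m"] bstep[of m] Suc.prems by (intro mult_right_mono) auto
    moreover have "(g (b m) - g (b 0)) / real ?D \<le> (\<Sum>i<Suc m. (c (Suc i) - c i) * g (b i)) - c (Suc m) * g (b m)"
      using Suc by simp
    ultimately show ?case by (simp add: algebra_simps diff_divide_distrib)
  qed
  have D1: "Suc (?D - 1) = ?D" by simp
  have "(g (b (?D - 1)) - g (b 0)) / real ?D \<le> (\<Sum>i<?D. (c (Suc i) - c i) * g (b i))"
    using abel[of "?D - 1"] by (simp add: D1 cD)
  also have "\<dots> = (\<Sum>i<?D. (real (N (Suc i)) - real (N i)) * g (b i)) - real (card X) / real ?D * (\<Sum>i<?D. g (b i))"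
    by (simp add: c_def sum_distrib_left sum_subtractf[symmetric] algebra_simps add_divide_distrib)
  also have "\<dots> \<le> (\<Sum>x\<in>X. g x) - real (card X) / real ?D * (\<Sum>i<?D. g (b i))"
    using sum_ge[of ?D] by (simp add: LD)
  finally have gain: "real (card X) / real ?D * (\<Sum>i<?D. g (b i)) + (g (b (?D - 1)) - g (b 0)) / real ?D
      \<le> (\<Sum>x\<in>X. g x)" by simp
  have "g (b 0) \<le> g x" if "x \<in> X" for x
    using that zero_notin_X by (intro bmin) auto
  moreover have "g (b i) \<le> g (b (?D - 1))" if "i < ?D" for i
    using that by (intro bmono) auto
  moreover have "b ` {..<?D} \<subseteq> X" using b by auto
  moreover have "span (b ` {..<?D}) = UNIV" using LD by (simp add: L_def)
  ultimately show ?thesis using that gain by blast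
qed

end

text \<open>Recovers a matrix \<open>S\<close> of trace 1 from any positive multiple of the Gram
  matrix \<open>transpose Y ** matrix_inv S ** Y\<close>.\<close>

definition congruence_shape :: "real^'n^'n \<Rightarrow> real^'n^'n \<Rightarrow> real^'n^'n" where
  "congruence_shape Y G = (1 / trace (Y ** matrix_inv G ** transpose Y)) *\<^sub>R (Y ** matrix_inv G ** transpose Y)"

lemma congruence_shape_spd:
  assumes "G \<in> spd" "invertible Y"
  shows "congruence_shape Y G \<in> spd" "trace (congruence_shape Y G) = 1"
proof -
  have s: "Y ** matrix_inv G ** transpose Y \<in> spd"
    by (intro spd_congruence spd_matrix_inv assms)
  then show "congruence_shape Y G \<in> spd" "trace (congruence_shape Y G) = 1"
    using spd_trace_pos[OF s] by (simp_all add: congruence_shape_def spd_scaleR trace_scaleR)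
qed

lemma continuous_on_congruence_shape:
  assumes "C \<subseteq> spd" "invertible Y"
  shows "continuous_on C (congruence_shape Y)"
  unfolding continuous_on_def
proof
  fix G assume "G \<in> C"
  then have G: "G \<in> spd" using assms by blast
  have "((\<lambda>G. Y ** matrix_inv G ** transpose Y) \<longlongrightarrow> Y ** matrix_inv G ** transpose Y) (at G within C)"
    by (intro tendsto_matrix_mult tendsto_matrix_inv tendsto_const tendsto_ident_at spd_invertible G)
  moreover have "trace (Y ** matrix_inv G ** transpose Y) \<noteq> 0"
    using spd_trace_pos[OF spd_congruence[OF spd_matrix_inv[OF G] assms(2)]] by simp
  ultimately show "(congruence_shape Y \<longlongrightarrow> congruence_shape Y G) (at G within C)"
    unfolding congruence_shape_def by (intro tendsto_intros tendsto_trace)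
qed

lemma congruence_shape_inverse:
  fixes S Y :: "real^'n^'n"
  assumes S: "S \<in> spd" and Y: "invertible Y" and tr: "trace S = 1" and t: "t > 0"
  shows "congruence_shape Y (t *\<^sub>R (transpose Y ** matrix_inv S ** Y)) = S"
proof -
  note iS = spd_invertible[OF S] and tY = transpose_invertible[OF Y]
  have "matrix_inv (transpose Y ** matrix_inv S ** Y) = matrix_inv Y ** S ** transpose (matrix_inv Y)"
    by (simp add: matrix_inv_mult invertible_mult Y tY iS invertible_matrix_inv matrix_inv_involution
        matrix_inv_transpose matrix_mul_assoc)
  moreover have "invertible (transpose Y ** matrix_inv S ** Y)"
    by (intro invertible_mult Y tY iS invertible_matrix_inv)
  ultimately have inv: "matrix_inv (t *\<^sub>R (transpose Y ** matrix_inv S ** Y)) = (1 / t) *\<^sub>R (matrix_inv Y ** S ** transpose (matrix_inv Y))"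
    using t by (simp add: matrix_inv_scaleR)
  have "Y ** (matrix_inv Y ** S ** transpose (matrix_inv Y)) ** transpose Y = S"
    using congruence_cancel[OF invertible_matrix_inv[OF Y], of S] by (simp add: matrix_inv_involution[OF Y])
  then have "Y ** matrix_inv (t *\<^sub>R (transpose Y ** matrix_inv S ** Y)) ** transpose Y = (1 / t) *\<^sub>R S"
    unfolding inv by (simp only: scaleR_matrix_mult_left scaleR_matrix_mult_right)
  then show ?thesis
    using t tr by (simp add: congruence_shape_def trace_scaleR)
qed

text \<open>The greedy basis varies with \<open>S\<close>, but only finitely many bases can occur;
  this makes the constants below uniform.\<close>

lemma finite_matrices_columns_in:
  fixes X :: "(real^'n) set"
  assumes "finite X"
  shows "finite {Y::real^'n^'n. \<forall>j. column j Y \<in> X}"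
proof (rule finite_subset)
  show "{Y::real^'n^'n. \<forall>j. column j Y \<in> X} \<subseteq> (\<lambda>f. \<chi> i j. f j $ i) ` (PiE UNIV (\<lambda>_. X))"
  proof
    fix Y :: "real^'n^'n" assume Y: "Y \<in> {Y. \<forall>j. column j Y \<in> X}"
    have "Y = (\<chi> i j. column j Y $ i)" by (simp add: column_def vec_eq_iff)
    then show "Y \<in> (\<lambda>f. \<chi> i j. f j $ i) ` (PiE UNIV (\<lambda>_. X))"
      using Y by (intro image_eqI[of _ _ "\<lambda>j. column j Y"]) auto
  qed
  show "finite ((\<lambda>f. \<chi> i j. f j $ i) ` (PiE (UNIV :: 'n set) (\<lambda>_. X)) :: (real^'n^'n) set)"
    using assms by (intro finite_imageI finite_PiE) auto
qed

lemma finite_pos_lower_bound: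
  fixes f :: "'a \<Rightarrow> real"
  assumes "finite A" "\<And>x. x \<in> A \<Longrightarrow> f x > 0"
  obtains k where "k > 0" "\<And>x. x \<in> A \<Longrightarrow> k \<le> f x"
proof -
  \<comment> \<open>Inserting 1 keeps the minimum meaningful for empty \<open>A\<close>.\<close>
  have "Min (insert 1 (f ` A)) > 0" "\<And>x. x \<in> A \<Longrightarrow> Min (insert 1 (f ` A)) \<le> f x"
    using assms by auto
  then show ?thesis using that by blast
qed

context sparse_config
begin

lemma Fobj_sublevel_compact:
  obtains K where "compact K" "K \<subseteq> {S \<in> spd. trace S = 1}"
    "\<forall>S\<in>spd. trace S = 1 \<longrightarrow> Fobj X S \<le> c \<longrightarrow> S \<in> K"
proof -
  let ?D = "CARD('n)"
  let ?N = "card X"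
  define Ys where "Ys = {Y::real^'n^'n. (\<forall>j. column j Y \<in> X) \<and> invertible Y}"
  have "finite Ys" unfolding Ys_def by (rule finite_subset[OF _ finite_matrices_columns_in[OF finite_X]]) auto
  moreover have "(det Y)^2 > 0" if "Y \<in> Ys" for Y
    using that by (simp add: Ys_def invertible_det_nz)
  ultimately obtain k where k: "k > 0" "\<And>Y. Y \<in> Ys \<Longrightarrow> k \<le> (det Y)^2"
    using finite_pos_lower_bound[of Ys "\<lambda>Y. (det Y)^2"] by blast
  \<comment> \<open>The exponent collects the estimates proved below:
    \<open>ln k + ?D * g (b 0) - ?D * c\<close> bounds \<open>ln (det G0)\<close> from below,
    \<open>ln ?D + g (b (?D - 1))\<close> bounds \<open>ln (trace G0)\<close> from above, and the
    last bracket bounds the spread of \<open>g\<close> on the basis.\<close>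
  define e where "e = exp (ln k - ?D * c - ?D * ln ?D - ?D * (?N * ?D * c - ?N * ln k))"
  define C where "C = {G::real^'n^'n. transpose G = G \<and> (\<forall>x. 0 \<le> x \<bullet> (G *v x)) \<and> trace G = 1 \<and> e \<le> det G}"
  define K where "K = (\<Union>Y\<in>Ys. congruence_shape Y ` C)"
  have epos: "e > 0" by (simp add: e_def)
  have Cspd: "C \<subseteq> spd"
    using epos by (auto simp: C_def intro!: psd_invertible_imp_spd)
  have "compact C" unfolding C_def by (rule compact_psd_det_ge)
  then have "compact K"
    unfolding K_def using \<open>finite Ys\<close> Cspd
    by (intro compact_UN compact_continuous_image continuous_on_congruence_shape) (auto simp: Ys_def)
  moreover have "K \<subseteq> {S \<in> spd. trace S = 1}"
  proof
    fix S assume "S \<in> K"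
    then obtain Y G where "invertible Y" "G \<in> C" "S = congruence_shape Y G"
      by (auto simp: K_def Ys_def)
    then show "S \<in> {S \<in> spd. trace S = 1}"
      using congruence_shape_spd[of G Y] Cspd by auto
  qed
  moreover have "S \<in> K" if S: "S \<in> spd" and tr: "trace S = 1" and le: "Fobj X S \<le> c" for S
  proof -
    define g where "g x = ln (x \<bullet> (matrix_inv S *v x))" for x
    obtain b :: "nat \<Rightarrow> real^'n" where b: "b ` {..<?D} \<subseteq> X" "span (b ` {..<?D}) = UNIV"
      "\<forall>x\<in>X. g (b 0) \<le> g x" "\<forall>i<?D. g (b i) \<le> g (b (?D - 1))"
      "real ?N / real ?D * (\<Sum>i<?D. g (b i)) + (g (b (?D - 1)) - g (b 0)) / real ?D \<le> (\<Sum>x\<in>X. g x)"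
      using greedy_basis_gain[of g] .
    obtain h :: "'n \<Rightarrow> nat" where h: "bij_betw h UNIV {..<?D}"
      using finite_same_card_bij[of "UNIV :: 'n set" "{..<?D}"] by auto
    have hlt: "h j < ?D" for j using h by (auto simp: bij_betw_def)
    define Y :: "real^'n^'n" where "Y = (\<chi> i j. b (h j) $ i)"
    have colY: "column j Y = b (h j)" for j by (simp add: Y_def column_def)
    have "columns Y = b ` range h" by (auto simp: columns_def colY)
    also have "range h = {..<?D}" using h by (simp add: bij_betw_def)
    finally have iY: "invertible Y"
      using b(2) matrix_right_invertible_span_columns[of Y] by (simp add: invertible_right_inverse span_vec_eq)
    then have YY: "Y \<in> Ys" using b(1) hlt by (auto simp: Ys_def colY)
    note kY = k(2)[OF YY]
    \<comment> \<open>The Gram matrix of the greedy basis for the form of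
      \<open>matrix_inv S\<close>; its diagonal consists of the values \<open>exp (g (b i))\<close>,
      which links it to the objective.\<close>
    define G0 where "G0 = transpose Y ** matrix_inv S ** Y"
    have G0: "G0 \<in> spd"
      unfolding G0_def using spd_congruence[OF spd_matrix_inv[OF S] transpose_invertible[OF iY]] by simp
    have diag: "G0 $ j $ j = exp (g (b (h j)))" for j
    proof -
      have "G0 $ j $ j = column j Y \<bullet> (matrix_inv S *v column j Y)"
        using inner_congruence[of "axis j 1" "transpose Y" "matrix_inv S"]
        by (simp add: diag_eq_inner G0_def matrix_vector_mult_basis del: transpose_matrix_vector)
      moreover have "b (h j) \<in> X" using b(1) hlt by blast
      ultimately show ?thesis
        using inner_inv_pos[OF S, of "b (h j)"] by (simp add: colY g_def)
    qed
    have reidx: "(\<Sum>j\<in>UNIV. f (h j)) = (\<Sum>i<?D. f i)" for f :: "nat \<Rightarrow> real"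
      using sum.reindex_bij_betw[OF h] .
    have had: "ln (det G0) \<le> (\<Sum>i<?D. g (b i))"
      using ln_det_le_sum_ln_diag[OF G0] reidx[of "\<lambda>i. g (b i)"] by (simp add: diag)
    have tr0: "trace G0 \<le> real ?D * exp (g (b (?D - 1)))"
      unfolding trace_def diag reidx[of "\<lambda>i. exp (g (b i))"]
      using sum_bounded_above[of "{..<?D}" "\<lambda>i. exp (g (b i))" "exp (g (b (?D - 1)))"] b(4) by simp
    have "det G0 = (det Y)^2 / det S"
      unfolding G0_def using det_matrix_inv[OF spd_invertible[OF S]] by (simp add: det_mul power2_eq_square)
    then have ldet: "ln (det G0) = ln ((det Y)^2) - ln (det S)"
      using spd_det_pos[OF S] iY by (simp add: ln_div invertible_det_nz)
    have lk: "ln k \<le> ln ((det Y)^2)" using kY k(1) by (intro ln_mono) auto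
    have Fle: "(\<Sum>x\<in>X. g x) / ?N + ln (det S) / ?D \<le> c"
      using le by (simp add: Fobj_def g_def)
    define \<Delta> where "\<Delta> = g (b (?D - 1)) - g (b 0)"
    have Npos: "real ?N > 0" and Dpos: "real ?D > 0" using card_X_pos by auto
    have sumle: "(\<Sum>x\<in>X. g x) \<le> ?N * c - ?N / ?D * ln (det S)"
    proof -
      have "?N * ((\<Sum>x\<in>X. g x) / ?N + ln (det S) / ?D) \<le> ?N * c" using Fle Npos by simp
      then show ?thesis using Npos by (simp add: distrib_left)
    qed
    have "?N / ?D * ln (det G0) + \<Delta> / ?D \<le> ?N * c - ?N / ?D * ln (det S)"
    proof -
      have "?N / ?D * ln (det G0) \<le> ?N / ?D * (\<Sum>i<?D. g (b i))" using had by (intro mult_left_mono) auto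
      then show ?thesis using b(5) sumle by (simp add: \<Delta>_def)
    qed
    \<comment> \<open>Multiplying out puts \<open>ln (det S)\<close> on the right with the factor
      \<open>- ?N\<close>; substituting \<open>ldet\<close> cancels it, so the spread is bounded
      independently of \<open>S\<close>.\<close>
    then have "?D * (?N / ?D * ln (det G0) + \<Delta> / ?D) \<le> ?D * (?N * c - ?N / ?D * ln (det S))"
      by (intro mult_left_mono) auto
    then have "?N * ln (det G0) + \<Delta> \<le> ?N * ?D * c - ?N * ln (det S)"
      using Dpos by (simp add: distrib_left right_diff_distrib mult_ac)
    then have "\<Delta> \<le> ?N * ?D * c - ?N * ln ((det Y)^2)"
      using ldet by (simp add: algebra_simps)
    moreover have "?N * ln k \<le> ?N * ln ((det Y)^2)" using lk by (intro mult_left_mono) auto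
    ultimately have Dl: "\<Delta> \<le> ?N * ?D * c - ?N * ln k" by linarith
    \<comment> \<open>Since \<open>b 0\<close> minimises \<open>g\<close> over all of
      \<open>X\<close>, the sublevel condition bounds \<open>ln (det S)\<close> above in terms of
      \<open>g (b 0)\<close>, and this bounds \<open>det G0\<close> below.\<close>
    have "?N * g (b 0) \<le> (\<Sum>x\<in>X. g x)" using b(3) by (intro sum_bounded_below) auto
    then have "?N * g (b 0) \<le> ?N * (c - ln (det S) / ?D)" using sumle by (simp add: right_diff_distrib)
    then have "g (b 0) \<le> c - ln (det S) / ?D" using Npos by simp
    then have "?D * g (b 0) \<le> ?D * (c - ln (det S) / ?D)" by (intro mult_left_mono) auto
    then have "?D * g (b 0) \<le> ?D * c - ln (det S)" using Dpos by (simp add: right_diff_distrib)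
    then have lG0: "ln k + ?D * g (b 0) - ?D * c \<le> ln (det G0)" using ldet lk by linarith
    have t0: "trace G0 > 0" by (rule spd_trace_pos[OF G0])
    have "ln (trace G0) \<le> ln (real ?D * exp (g (b (?D - 1))))" using tr0 t0 by (intro ln_mono) auto
    also have "\<dots> = ln ?D + g (b (?D - 1))" by (simp add: ln_mult_pos)
    finally have ltr: "?D * ln (trace G0) \<le> ?D * (ln ?D + g (b (?D - 1)))" by (intro mult_left_mono) auto
    have G: "(1 / trace G0) *\<^sub>R G0 \<in> C"
    proof -
      have s: "(1 / trace G0) *\<^sub>R G0 \<in> spd" using G0 t0 by (simp add: spd_scaleR)
      have "ln (det ((1 / trace G0) *\<^sub>R G0)) = ln (det G0) - ?D * ln (trace G0)"
        using t0 spd_det_pos[OF G0] by (simp add: det_scaleR ln_div ln_realpow power_one_over)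
      moreover have "?D * \<Delta> \<le> ?D * (?N * ?D * c - ?N * ln k)" using Dl by (intro mult_left_mono) auto
      ultimately have "ln k - ?D * c - ?D * ln ?D - ?D * (?N * ?D * c - ?N * ln k) \<le> ln (det ((1 / trace G0) *\<^sub>R G0))"
        using lG0 ltr by (simp add: \<Delta>_def right_diff_distrib distrib_left)
      then have "e \<le> det ((1 / trace G0) *\<^sub>R G0)"
        unfolding e_def using spd_det_pos[OF s] by (metis exp_le_cancel_iff exp_ln)
      moreover have "0 \<le> x \<bullet> (((1 / trace G0) *\<^sub>R G0) *v x)" for x
        using spd_inner_pos[OF s, of x] by (cases "x = 0") auto
      moreover have "trace ((1 / trace G0) *\<^sub>R G0) = 1" using t0 by (simp add: trace_scaleR)
      ultimately show ?thesis using spd_transpose[OF s] by (simp add: C_def)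
    qed
    have "congruence_shape Y ((1 / trace G0) *\<^sub>R G0) = S"
      unfolding G0_def using t0[unfolded G0_def] by (intro congruence_shape_inverse S iY tr) simp
    then show ?thesis unfolding K_def using YY G by (metis UN_I image_eqI)
  qed
  ultimately show ?thesis using that by blast
qed

end

subsection \<open>Convergence\<close>

text \<open>A subsequence staying outside a neighbourhood of \<open>a\<close> would, by compactness,
  have a further subsequence with a limit other than \<open>a\<close>.\<close>

lemma LIMSEQ_compact_unique_limit_point:
  fixes s :: "nat \<Rightarrow> 'a::metric_space"
  assumes K: "compact K" "\<And>n. s n \<in> K"
    and uniq: "\<And>r l. strict_mono r \<Longrightarrow> (s \<circ> r) \<longlonglongrightarrow> l \<Longrightarrow> l = a"
  shows "s \<longlonglongrightarrow> a"
proof (rule topological_tendstoI, rule ccontr)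
  fix U assume U: "open U" "a \<in> U" and "\<not> eventually (\<lambda>n. s n \<in> U) sequentially"
  then obtain r :: "nat \<Rightarrow> nat" where r: "strict_mono r" "\<And>n. s (r n) \<notin> U"
    using not_eventually_sequentiallyD by blast
  have "\<forall>n. (s \<circ> r) n \<in> K" using K(2) by simp
  then obtain l r' where r': "strict_mono r'" "((s \<circ> r) \<circ> r') \<longlonglongrightarrow> l"
    using seq_compactE[OF compact_imp_seq_compact[OF K(1)]] by metis
  then have "l = a" using uniq[of "r \<circ> r'" l] r(1) by (simp add: strict_mono_o o_assoc)
  then have "eventually (\<lambda>n. ((s \<circ> r) \<circ> r') n \<in> U) sequentially"
    using topological_tendstoD[OF r'(2) U(1)] U(2) by simp
  then obtain n where "((s \<circ> r) \<circ> r') n \<in> U" by (auto simp: eventually_sequentially)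
  then show False using r(2) by simp
qed

context sparse_config
begin

lemma Top_iteration_converges:
  assumes S0: "Sig 0 \<in> spd" and step: "\<And>k. Sig (Suc k) = Top X (Sig k)"
  shows "\<exists>S. S \<in> spd \<and> trace S = 1
            \<and> (\<forall>S'. S' \<in> spd \<and> trace S' = 1 \<and> S' \<noteq> S \<longrightarrow> Fobj X S < Fobj X S')
            \<and> Sig \<longlonglongrightarrow> S"
proof -
  have spd: "Sig k \<in> spd" for k
    by (induction k) (simp_all add: S0 step Top_spd)
  \<comment> \<open>\<open>Sig 0\<close> may have any trace; from index 1 on the trace is 1, so the
    argument runs on the shifted sequence.\<close>
  define s where "s k = Sig (Suc k)" for k
  define f where "f k = Fobj X (s k)" for k
  have s: "s k \<in> spd" "trace (s k) = 1" for k
    using spd by (simp_all add: s_def step trace_Top Top_spd)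
  have sstep: "s (Suc k) = Top X (s k)" for k by (simp add: s_def step)
  have "f (Suc k) \<le> f k" for k
    using Fobj_scatter_le[OF s(1)] by (simp add: f_def sstep Fobj_Top s)
  then have dec: "f j \<le> f i" if "i \<le> j" for i j using that by (rule lift_Suc_antimono_le)
  obtain K where K: "compact K" "K \<subseteq> {S \<in> spd. trace S = 1}"
    "\<forall>S\<in>spd. trace S = 1 \<longrightarrow> Fobj X S \<le> f 0 \<longrightarrow> S \<in> K"
    using Fobj_sublevel_compact[of "f 0"] .
  have sK: "s k \<in> K" for k
    using dec[of 0 k] K(3) s by (simp add: f_def)
  have limit_fixed: "l \<in> spd \<and> trace l = 1 \<and> scatter X l = l"
    if r: "strict_mono r" and lim: "(s \<circ> r) \<longlonglongrightarrow> l" for r l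
  proof -
    have "l \<in> K"
      by (rule closed_sequentially[OF compact_imp_closed[OF K(1)] _ lim]) (simp add: sK)
    then have l: "l \<in> spd" "trace l = 1" using K(2) by blast+
    have 1: "(\<lambda>k. f (r k)) \<longlonglongrightarrow> Fobj X l"
      using tendsto_Fobj[OF lim l(1)] by (simp add: f_def)
    have 2: "(\<lambda>k. f (Suc (r k))) \<longlonglongrightarrow> Fobj X (Top X l)"
      using tendsto_Fobj[OF tendsto_Top[OF lim l(1)] Top_spd[OF l(1)]] by (simp add: f_def sstep)
    \<comment> \<open>As \<open>r\<close> is strictly increasing, \<open>r (Suc k)\<close> is at
      least \<open>Suc (r k)\<close>. Monotone decrease then compares the limit value with the value
      one step later, so the step at \<open>l\<close> cannot lower the objective.\<close>
    have "f (r (Suc k)) \<le> f (Suc (r k))" for k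
      using strict_monoD[OF r, of k "Suc k"] by (intro dec) simp
    then have "Fobj X l \<le> Fobj X (Top X l)"
      by (intro LIMSEQ_le[OF LIMSEQ_Suc[OF 1] 2]) auto
    then have "Fobj X (scatter X l) = Fobj X l"
      using Fobj_scatter_le[OF l(1)] by (simp add: Fobj_Top l)
    then show ?thesis using l Fobj_scatter_eq by blast
  qed
  \<comment> \<open>Existence of the minimiser comes from the iteration itself: some limit point
    exists by compactness, and it is a fixed point.\<close>
  obtain S r where S: "strict_mono r" "(s \<circ> r) \<longlonglongrightarrow> S"
    using seq_compactE[OF compact_imp_seq_compact[OF K(1)]] sK by metis
  have fixS: "S \<in> spd" "trace S = 1" "scatter X S = S" using limit_fixed[OF S] by auto
  have min: "Fobj X S < Fobj X S'" if "S' \<in> spd" "trace S' = 1" "S' \<noteq> S" for S'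
    using scatter_fixed_point_strict_minimizer[OF fixS(1) that(1) fixS(3)] that fixS(2) by force
  \<comment> \<open>Two limit points are both fixed points, so each would have a strictly smaller
    objective than the other.\<close>
  have "l = S" if "strict_mono r" "(s \<circ> r) \<longlonglongrightarrow> l" for r l
  proof (rule ccontr)
    assume "l \<noteq> S"
    have l: "l \<in> spd" "trace l = 1" "scatter X l = l" using limit_fixed[OF that] by auto
    have "\<not> Fobj X S \<le> Fobj X l"
      using scatter_fixed_point_strict_minimizer[OF l(1) fixS(1) l(3)] l(2) fixS(2) \<open>l \<noteq> S\<close> by auto
    then show False using min[OF l(1,2) \<open>l \<noteq> S\<close>] by simp
  qed
  then have "s \<longlonglongrightarrow> S" by (rule LIMSEQ_compact_unique_limit_point[OF K(1) sK])
  then have "Sig \<longlonglongrightarrow> S" unfolding s_def by (rule LIMSEQ_imp_Suc)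
  then show ?thesis using fixS min by blast
qed

end

theorem theorem3:
  fixes X :: "(real^'n) set" and Sig :: "nat \<Rightarrow> real^'n^'n"
  assumes "finite X" and "X \<noteq> {}" and "0 \<notin> X"
    and "\<forall>L :: (real^'n) set. subspace L \<and> 1 \<le> dim L \<and> dim L \<le> CARD('n) - 1 \<longrightarrow>
           real (card (X \<inter> L)) / real (card X) < real (dim L) / real CARD('n)"
    and "Sig 0 \<in> spd"
    and "\<forall>k. Sig (Suc k) = Top X (Sig k)"
  shows "\<exists>S. S \<in> spd \<and> trace S = 1
            \<and> (\<forall>S'. S' \<in> spd \<and> trace S' = 1 \<and> S' \<noteq> S \<longrightarrow> Fobj X S < Fobj X S')
            \<and> Sig \<longlonglongrightarrow> S"
proof -
  have "card X > 0" using assms(1,2) by (simp add: card_gt_0_iff)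
  then interpret sparse_config X
  proof (unfold_locales, goal_cases)
    \<comment> \<open>Passes from the quotient form of the counting hypothesis to the integer form
      of the locale.\<close>
    case (4 L)
    then have "real (card (X \<inter> L)) / real (card X) < real (dim L) / real CARD('n)"
      using assms(4) by simp
    then have "real (card (X \<inter> L)) * real CARD('n) < real (dim L) * real (card X)"
      using \<open>card X > 0\<close> by (simp add: divide_less_eq field_simps)
    then have "real (card (X \<inter> L) * CARD('n)) < real (dim L * card X)" by simp
    then show ?case by (simp only: of_nat_less_iff)
  qed (use assms in auto)
  show ?thesis using assms(5,6) by (intro Top_iteration_converges) auto
qed

end
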